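(* Let $(\mathbf{D}, \leq_T)$ be the set of all Turing degrees partially ordered by Turing reducibility and let $(\mathbf{I}, \leq_g)$ be the set of all generic degrees partially ordered by generic reducibility. Then the function $\mathfrak{B} : \mathbf{D} \to \mathbf{I}$ defined by $\boldsymbol{a} \mapsto \deg_g(\mathcal{R}(\boldsymbol{a}))$, where $\deg_g(\mathcal{R}(\boldsymbol{a}))$ denotes $\deg_g(\mathcal{R}(A))$ for any $A \in \boldsymbol{a}$ (this is well-defined), is an order embedding.
   Context: $\omega = \{0,1,2,\dots\}$. For $k \in \omega$, $R_k = \{ m \in \omega : 2^k \mid m,\ 2^{k+1} \nmid m \}$, and for $A \subseteq \omega$, $\mathcal{R}(A) = \bigcup_{n \in A} R_n$. The density of $S \subseteq \omega$ is $\lim_{n\to\infty} \frac{|S \cap [0,n]|}{n+1}$, when this limit exists. A generic description of $A \subseteq \omega$ is a partial function $\Psi$ from $\omega$ to $\{0,1\}$ which agrees with the characteristic function of $A$ on its domain and whose domain has density $1$. For a partial function $\Psi$, $\gamma(\Psi) = \{\langle a,b\rangle : \Psi(a) = b\}$, the set of codes of pairs in its graph. An enumeration operator is a c.e. set $W$, whose elements are viewed as codes of pairs $\langle n, D\rangle$ with $n \in \omega$ and $D \subseteq \omega$ finite (identified with its canonical index $\sum_{k\in D}2^k$); it acts on sets by $W(X) = \{ n : (\exists D)[\langle n, D\rangle \in W \ \&\ D \subseteq X]\}$. $A$ is generically reducible to $B$ ($A \leq_g B$) if there is an enumeration operator $W$ such that for every generic description $\Psi$ of $B$, $W(\gamma(\Psi))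 = \gamma(\Theta)$ for some generic description $\Theta$ of $A$. The relation $\leq_g$ is reflexive and transitive; $A \equiv_g B$ means $A \leq_g B$ and $B \leq_g A$; the generic degree of $A$ is $\deg_g(A) = \{C : C \equiv_g A\}$, and generic degrees are partially ordered by the ordering induced by $\leq_g$. An order embedding is a map $f$ with $x \leq y$ if and only if $f(x) \leq f(y)$ (hence injective). *)

theory Defs
  imports Complex_Main "HOL-Library.Nat_Bijection" "HOL-Library.Indicator_Function"
begin

subsection \<open>Relative computability\<close>

text \<open>
  Expressions for Kleene's partial \<open>\<mu>\<close>-recursive functions relative to a set.  They carry
  no fixed arity: \<^term>\<open>Zero\<close>, \<^term>\<open>Proj i\<close> and \<^term>\<open>Comp f []\<close> make sense on
  argument lists of different lengths.
\<close>

datatype rexp =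
    Zero
  | Succ
  | Proj nat
  | Query
  | Comp rexp "rexp list"
  | Prec rexp rexp
  | Mu rexp

text \<open>
  \<open>computes X e xs y\<close>: relative to the set \<open>X\<close>, the expression \<open>e\<close> halts on the arguments \<open>xs\<close> with
  value \<open>y\<close>.  The recursion variable of \<^term>\<open>Prec\<close> and the search variable of
  \<^term>\<open>Mu\<close> are the first argument.
\<close>

inductive computes :: "nat set \<Rightarrow> rexp \<Rightarrow> nat list \<Rightarrow> nat \<Rightarrow> bool" for X :: "nat set" where
  zero: "computes X Zero xs 0"
| succ: "computes X Succ [x] (Suc x)"
| proj: "i < length xs \<Longrightarrow> computes X (Proj i) xs (xs ! i)"
| query: "computes X Query [x] (indicator X x)"
| comp: "list_all2 (\<lambda>g y. computes X g xs y) gs ys \<Longrightarrow> computes X f ys z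
    \<Longrightarrow> computes X (Comp f gs) xs z"
| prec_0: "computes X f xs y \<Longrightarrow> computes X (Prec f g) (0 # xs) y"
| prec_Suc: "computes X (Prec f g) (n # xs) y \<Longrightarrow> computes X g (n # y # xs) z
    \<Longrightarrow> computes X (Prec f g) (Suc n # xs) z"
| mu: "computes X f (y # xs) 0 \<Longrightarrow> (\<forall>i<y. \<exists>v. computes X f (i # xs) (Suc v))
    \<Longrightarrow> computes X (Mu f) xs y"

lemma computes_deterministic:
  "computes X e xs y \<Longrightarrow> computes X e xs z \<Longrightarrow> y = z"
proof (induction arbitrary: z rule: computes.induct)
  case (comp xs gs ys f w)
  from comp.prems obtain ys' where
    ys': "list_all2 (\<lambda>g y. computes X g xs y) gs ys'" "computes X f ys' z"
    by cases auto
  have "ys = ys'"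
  proof (rule nth_equalityI)
    show "length ys = length ys'"
      using comp.IH(1) ys'(1) by (auto dest!: list_all2_lengthD)
    fix i assume "i < length ys"
    then show "ys ! i = ys' ! i"
      using comp.IH(1) ys'(1) by (auto simp: list_all2_conv_all_nth)
  qed
  then show ?case using comp.IH ys'(2) by blast
next
  case (prec_0 f xs y g)
  from prec_0.prems show ?case by cases (use prec_0.IH in auto)
next
  case (prec_Suc f g n xs y w)
  from prec_Suc.prems show ?case by cases (use prec_Suc.IH in blast)
next
  case (mu f y xs)
  from mu.prems have z: "computes X f (z # xs) 0" "\<forall>i<z. \<exists>v. computes X f (i # xs) (Suc v)"
    by (cases, simp)+
  show ?case
  proof (rule linorder_cases[of y z])
    assume "y < z"
    then show ?thesis using z(2) mu.IH(1) by (metis nat.distinct(1))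
  next
    assume "z < y"
    then show ?thesis using z(1) mu.IH(2) by (metis nat.distinct(1))
  qed
qed (auto elim: computes.cases)

definition computable_in :: "nat set \<Rightarrow> (nat \<Rightarrow> nat) \<Rightarrow> bool" where
  "computable_in X f \<longleftrightarrow> (\<exists>e. \<forall>n. computes X e [n] (f n))"

definition turing_reducible :: "nat set \<Rightarrow> nat set \<Rightarrow> bool" (infix "\<le>\<^sub>T" 50) where
  "A \<le>\<^sub>T B \<longleftrightarrow> computable_in B (indicator A)"

text \<open>Plain computability is computability relative to the empty set.\<close>

definition computably_enumerable :: "nat set \<Rightarrow> bool" where
  "computably_enumerable W \<longleftrightarrow> W = {} \<or> (\<exists>f. computable_in {} f \<and> W = range f)"


subsection \<open>Generic reducibility\<close>

definition has_density :: "nat set \<Rightarrow> real \<Rightarrow> bool" where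
  "has_density S d \<longleftrightarrow> (\<lambda>n. real (card (S \<inter> {0..n})) / real (n + 1)) \<longlonglongrightarrow> d"

definition generic_description :: "(nat \<rightharpoonup> nat) \<Rightarrow> nat set \<Rightarrow> bool" where
  "generic_description \<Psi> A \<longleftrightarrow>
     (\<forall>n\<in>dom \<Psi>. \<Psi> n = Some (indicator A n)) \<and> has_density (dom \<Psi>) 1"

definition graph_codes :: "(nat \<rightharpoonup> nat) \<Rightarrow> nat set" where
  "graph_codes \<Psi> = {prod_encode (a, b) | a b. \<Psi> a = Some b}"

text \<open>\<^term>\<open>set_encode\<close> is the canonical index of a finite set.\<close>

definition enum_op :: "nat set \<Rightarrow> nat set \<Rightarrow> nat set" where
  "enum_op W X = {n. \<exists>D. finite D \<and> prod_encode (n, set_encode D) \<in> W \<and> D \<subseteq> X}"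

definition generic_reducible :: "nat set \<Rightarrow> nat set \<Rightarrow> bool" (infix "\<le>\<^sub>g" 50) where
  "A \<le>\<^sub>g B \<longleftrightarrow> (\<exists>W. computably_enumerable W \<and>
     (\<forall>\<Psi>. generic_description \<Psi> B \<longrightarrow>
        (\<exists>\<Theta>. generic_description \<Theta> A \<and> enum_op W (graph_codes \<Psi>) = graph_codes \<Theta>)))"


subsection \<open>Degrees\<close>

definition turing_degree :: "nat set \<Rightarrow> nat set set" where
  "turing_degree A = {C. C \<le>\<^sub>T A \<and> A \<le>\<^sub>T C}"

definition turing_degrees :: "nat set set set" where
  "turing_degrees = range turing_degree"

definition turing_degree_le :: "nat set set \<Rightarrow> nat set set \<Rightarrow> bool" where
  "turing_degree_le a b \<longleftrightarrow> (\<exists>A\<in>a. \<exists>B\<in>b. A \<le>\<^sub>T B)"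

definition generic_degree :: "nat set \<Rightarrow> nat set set" where
  "generic_degree A = {C. C \<le>\<^sub>g A \<and> A \<le>\<^sub>g C}"

definition generic_degrees :: "nat set set set" where
  "generic_degrees = range generic_degree"

definition generic_degree_le :: "nat set set \<Rightarrow> nat set set \<Rightarrow> bool" where
  "generic_degree_le a b \<longleftrightarrow> (\<exists>A\<in>a. \<exists>B\<in>b. A \<le>\<^sub>g B)"

definition order_embedding ::
    "'a set \<Rightarrow> ('a \<Rightarrow> 'a \<Rightarrow> bool) \<Rightarrow> 'b set \<Rightarrow> ('b \<Rightarrow> 'b \<Rightarrow> bool) \<Rightarrow> ('a \<Rightarrow> 'b) \<Rightarrow> bool" where
  "order_embedding P leP Q leQ f \<longleftrightarrow>
     f ` P \<subseteq> Q \<and> (\<forall>x\<in>P. \<forall>y\<in>P. leP x y \<longleftrightarrow> leQ (f x) (f y))"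


subsection \<open>The map on degrees\<close>

definition R_layer :: "nat \<Rightarrow> nat set" where
  "R_layer k = {m. 2 ^ k dvd m \<and> \<not> 2 ^ (k + 1) dvd m}"

definition R_set :: "nat set \<Rightarrow> nat set" where
  "R_set A = (\<Union>n\<in>A. R_layer n)"

text \<open>The value does not depend on the chosen representative; this is part of the theorem.\<close>

definition degree_map :: "nat set set \<Rightarrow> nat set set" where
  "degree_map a = generic_degree (R_set (SOME A. A \<in> a))"

end

theory Submission imports Defs begin

text \<open>
  Turing reducibility of sets is enumeration reducibility of the graphs of their characteristic
  functions (\<open>turing_reducible_iff_effective\<close>), and generic reducibility asks for an enumeration
  operator on partial graphs. The two notions meet because the coding \<open>A \<mapsto> R_set A\<close> can be
  undone on generic descriptions: the layer \<open>R_layer k\<close> has positive density, so the domain of a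
  generic description of \<open>R_set A\<close>, having density one, meets it (\<open>meets_R_layer_if_density_1\<close>),
  and the value found there tells whether \<open>k\<close> belongs to \<open>A\<close>. Hence one enumeration operator,
  \<open>collapse\<close>, recovers the graph of \<open>A\<close> from every generic description of \<open>R_set A\<close>, and another
  one, \<open>spread\<close>, produces the graph of \<open>R_set A\<close> from the graph of \<open>A\<close>. Composing with these two
  operators turns operators that witness \<open>A \<le>\<^sub>T B\<close> into operators that witness \<open>R_set A \<le>\<^sub>g
  R_set B\<close> and vice versa (\<open>R_set_generic_reducible_iff\<close>). As enumeration operators compose,
  both reducibilities are preorders, and the statement about degrees follows.

  To exhibit an operator, one writes it as a formula in which the input set occurs only
  positively; a calculus of closure properties, for computable functions, then semidecidable
  predicates, then enumeration operators, shows that such a formula defines an operator with a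
  c.e. set of axioms. Programs enter through an induction on expressions (\<open>computes_effective\<close>),
  which turns the halting computations of one expression into such a formula.
\<close>

section \<open>Functions computable from an oracle\<close>

text \<open>
  Argument lists of every length are needed at first, since \<^const>\<open>Prec\<close> and \<^const>\<open>Mu\<close> pass their bound
  variable as an additional argument. Once pairing and its projections are known to be
  computable, a single argument suffices, and the rest of the development deals with unary
  functions only.
\<close>

definition computable_on :: "nat set \<Rightarrow> nat \<Rightarrow> (nat list \<Rightarrow> nat) \<Rightarrow> bool" where
  "computable_on X k F \<longleftrightarrow> (\<exists>e. \<forall>xs. length xs = k \<longrightarrow> computes X e xs (F xs))"

named_theorems computable_on_intros

lemma computable_on_nth [computable_on_intros]:
  "i < k \<Longrightarrow> computable_on X k (\<lambda>xs. xs ! i)"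
  unfolding computable_on_def by (intro exI[of _ "Proj i"]) (auto intro: computes.proj)

lemma computable_on_comp:
  assumes "computable_on X (length Gs) F" and "\<forall>G\<in>set Gs. computable_on X k G"
  shows "computable_on X k (\<lambda>xs. F (map (\<lambda>G. G xs) Gs))"
proof -
  obtain e where e: "\<forall>xs. length xs = length Gs \<longrightarrow> computes X e xs (F xs)"
    using assms(1) unfolding computable_on_def by blast
  obtain c where c: "\<forall>G\<in>set Gs. \<forall>xs. length xs = k \<longrightarrow> computes X (c G) xs (G xs)"
    using bchoice[OF assms(2)[unfolded computable_on_def]] by blast
  have "computes X (Comp e (map c Gs)) xs (F (map (\<lambda>G. G xs) Gs))" if "length xs = k" for xs
  proof (rule computes.comp)
    show "list_all2 (\<lambda>g y. computes X g xs y) (map c Gs) (map (\<lambda>G. G xs) Gs)"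
      using c that by (auto simp: list_all2_conv_all_nth)
  qed (use e in simp)
  then show ?thesis unfolding computable_on_def by blast
qed

lemma computable_on_rec:
  assumes "computable_on X k F" and "computable_on X (Suc (Suc k)) G"
  shows "computable_on X (Suc k) (\<lambda>xs. rec_nat (F (tl xs)) (\<lambda>i r. G (i # r # tl xs)) (hd xs))"
proof -
  obtain f where f: "\<forall>xs. length xs = k \<longrightarrow> computes X f xs (F xs)"
    using assms(1) unfolding computable_on_def by blast
  obtain g where g: "\<forall>xs. length xs = Suc (Suc k) \<longrightarrow> computes X g xs (G xs)"
    using assms(2) unfolding computable_on_def by blast
  have rec: "computes X (Prec f g) (n # xs) (rec_nat (F xs) (\<lambda>i r. G (i # r # xs)) n)"
    if "length xs = k" for n xs
  proof (induction n)
    case 0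
    show ?case using f that by (auto intro: computes.prec_0)
  next
    case (Suc n)
    from computes.prec_Suc[OF Suc] show ?case using g that by simp
  qed
  have "computes X (Prec f g) xs (rec_nat (F (tl xs)) (\<lambda>i r. G (i # r # tl xs)) (hd xs))"
    if "length xs = Suc k" for xs
    using that rec[of "tl xs" "hd xs"] by (cases xs) auto
  then show ?thesis unfolding computable_on_def by blast
qed

lemma computable_on_Least:
  assumes "computable_on X (Suc k) F" and "\<And>xs. length xs = k \<Longrightarrow> \<exists>y. F (y # xs) = 0"
  shows "computable_on X k (\<lambda>xs. LEAST y. F (y # xs) = 0)"
proof -
  obtain f where f: "\<forall>xs. length xs = Suc k \<longrightarrow> computes X f xs (F xs)"
    using assms(1) unfolding computable_on_def by blast
  have "computes X (Mu f) xs (LEAST y. F (y # xs) = 0)" if len: "length xs = k" for xs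
  proof (rule computes.mu)
    show "computes X f ((LEAST y. F (y # xs) = 0) # xs) 0"
      using f[rule_format, of "(LEAST y. F (y # xs) = 0) # xs"] LeastI_ex[OF assms(2)[OF len]] len
      by simp
    show "\<forall>i<LEAST y. F (y # xs) = 0. \<exists>v. computes X f (i # xs) (Suc v)"
    proof (intro allI impI)
      fix i assume "i < (LEAST y. F (y # xs) = 0)"
      then have "F (i # xs) \<noteq> 0" using not_less_Least by blast
      then show "\<exists>v. computes X f (i # xs) (Suc v)"
        using f[rule_format, of "i # xs"] len by (metis length_Cons not0_implies_Suc)
    qed
  qed
  then show ?thesis unfolding computable_on_def by blast
qed

lemma computable_on_cong:
  "computable_on X k F \<Longrightarrow> (\<And>xs. length xs = k \<Longrightarrow> F xs = G xs) \<Longrightarrow> computable_on X k G"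
  unfolding computable_on_def by metis

lemma computable_in_iff: "computable_in X f \<longleftrightarrow> computable_on X 1 (\<lambda>xs. f (xs ! 0))"
proof -
  have "(\<forall>n. computes X e [n] (f n)) \<longleftrightarrow> (\<forall>xs. length xs = 1 \<longrightarrow> computes X e xs (f (xs ! 0)))" for e
    by (auto simp: length_Suc_conv)
  then show ?thesis unfolding computable_in_def computable_on_def by blast
qed

definition computable2 :: "nat set \<Rightarrow> (nat \<Rightarrow> nat \<Rightarrow> nat) \<Rightarrow> bool" where
  "computable2 X h \<longleftrightarrow> computable_on X 2 (\<lambda>xs. h (xs ! 0) (xs ! 1))"

lemma computable_on_app1:
  "computable_in X f \<Longrightarrow> computable_on X k F \<Longrightarrow> computable_on X k (\<lambda>xs. f (F xs))"
  using computable_on_comp[of X "[F]" "\<lambda>xs. f (xs ! 0)" k] by (simp add: computable_in_iff)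

lemma computable_on_app2:
  "computable2 X h \<Longrightarrow> computable_on X k F \<Longrightarrow> computable_on X k G
    \<Longrightarrow> computable_on X k (\<lambda>xs. h (F xs) (G xs))"
  using computable_on_comp[of X "[F, G]" "\<lambda>xs. h (xs ! 0) (xs ! 1)" k]
  by (simp add: computable2_def numeral_2_eq_2)

lemma computable_in_app1:
  "computable_in X f \<Longrightarrow> computable_in X g \<Longrightarrow> computable_in X (\<lambda>n. f (g n))"
  using computable_on_app1 by (auto simp: computable_in_iff)

lemma computable_in_app2:
  "computable2 X h \<Longrightarrow> computable_in X f \<Longrightarrow> computable_in X g \<Longrightarrow> computable_in X (\<lambda>n. h (f n) (g n))"
  using computable_on_app2 by (auto simp: computable_in_iff)

lemma computable_in_Suc_fun: "computable_in X Suc"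
  unfolding computable_in_def by (blast intro: computes.succ)

lemma computable_in_oracle_fun: "computable_in X (indicator X)"
  unfolding computable_in_def by (blast intro: computes.query)

lemma computable_on_const [computable_on_intros]: "computable_on X k (\<lambda>_. c)"
proof (induction c)
  case 0
  then show ?case unfolding computable_on_def by (blast intro: computes.zero)
next
  case (Suc c)
  then show ?case using computable_on_app1[OF computable_in_Suc_fun] by blast
qed

lemma computable_on_Suc [computable_on_intros]:
  "computable_on X k F \<Longrightarrow> computable_on X k (\<lambda>xs. Suc (F xs))"
  by (rule computable_on_app1[OF computable_in_Suc_fun])

lemma computable2_rec:
  assumes "computable_in X b" and "computable_on X 3 (\<lambda>xs. s (xs ! 0) (xs ! 1) (xs ! 2))"
  shows "computable2 X (\<lambda>n x. rec_nat (b x) (\<lambda>i r. s i r x) n)"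
proof -
  have "computable_on X (Suc 1)
     (\<lambda>xs. rec_nat (b (tl xs ! 0)) (\<lambda>i r. s ((i # r # tl xs) ! 0) ((i # r # tl xs) ! 1)
       ((i # r # tl xs) ! 2)) (hd xs))"
    using assms by (intro computable_on_rec) (auto simp: computable_in_iff numeral_3_eq_3)
  then have "computable_on X 2 (\<lambda>xs. rec_nat (b (tl xs ! 0)) (\<lambda>i r. s i r (tl xs ! 0)) (hd xs))"
    by (simp add: numeral_2_eq_2)
  then show ?thesis unfolding computable2_def
    by (rule computable_on_cong) (auto simp: length_Suc_conv numeral_2_eq_2)
qed

lemma computable_in_id: "computable_in X (\<lambda>n. n)"
  unfolding computable_in_iff by (intro computable_on_nth) simp

lemma computable_in_const: "computable_in X (\<lambda>n. c)"
  unfolding computable_in_iff by (rule computable_on_const)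

lemma computable_in_rec_fun:
  assumes "computable2 X s"
  shows "computable_in X (rec_nat c s)"
proof -
  have "computable2 X (\<lambda>n x. rec_nat c (\<lambda>i r. s i r) n)"
    using computable_on_app2[OF assms computable_on_nth computable_on_nth]
    by (intro computable2_rec computable_in_const) simp
  from computable_in_app2[OF this computable_in_id computable_in_id] show ?thesis by simp
qed

lemma computable2_add: "computable2 X (+)"
proof -
  have "computable2 X (\<lambda>n x. rec_nat x (\<lambda>i r. Suc r) n)"
    by (intro computable2_rec computable_in_id computable_on_intros) simp
  moreover have "rec_nat x (\<lambda>i r. Suc r) n = n + x" for n x :: nat by (induction n) auto
  ultimately show ?thesis by simp
qed

lemma computable_in_pred_fun: "computable_in X (\<lambda>n. n - 1)"
proof -
  have "computable_in X (rec_nat 0 (\<lambda>i r. i))"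
    by (intro computable_in_rec_fun) (simp add: computable2_def computable_on_nth)
  moreover have "rec_nat 0 (\<lambda>i r. i) = (\<lambda>n. n - 1)"
  proof
    show "rec_nat 0 (\<lambda>i r. i) n = n - 1" for n by (cases n) auto
  qed
  ultimately show ?thesis by simp
qed

lemma computable2_diff: "computable2 X (\<lambda>n x. x - n)"
proof -
  have "computable2 X (\<lambda>n x. rec_nat x (\<lambda>i r. r - 1) n)"
    by (intro computable2_rec computable_in_id computable_on_app1[OF computable_in_pred_fun]
        computable_on_intros) simp
  moreover have "rec_nat x (\<lambda>i r. r - 1) n = x - n" for n x :: nat by (induction n) auto
  ultimately show ?thesis by simp
qed

named_theorems computable

lemmas computable_basic [computable] =
  computable_in_id computable_in_const
  computable_in_app1[OF computable_in_Suc_fun] computable_in_app1[OF computable_in_oracle_fun]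
  computable_in_app2[OF computable2_add]

lemma computable_in_diff [computable]:
  "computable_in X f \<Longrightarrow> computable_in X g \<Longrightarrow> computable_in X (\<lambda>n. f n - g n)"
  by (rule computable_in_app2[OF computable2_diff])

subsection \<open>Pairing\<close>

text \<open>
  From here on, a function of several variables is a function of one number \<open>z\<close> that reads its
  variables off as projections of \<open>z\<close>. A rule for a binder therefore has a premise about \<open>\<lambda>z. P
  (pfst z) (psnd z)\<close>, where \<^term>\<open>pfst z\<close> is the surrounding argument and \<^term>\<open>psnd z\<close> the bound
  variable. Since every rule is selected by the outermost symbol of its conclusion,
  computability of an explicit term or formula is proved by \<open>intro\<close>.
\<close>

abbreviation pair :: "nat \<Rightarrow> nat \<Rightarrow> nat" ("\<langle>_,/ _\<rangle>") where "\<langle>x, y\<rangle> \<equiv> prod_encode (x, y)"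
abbreviation pfst :: "nat \<Rightarrow> nat" where "pfst z \<equiv> fst (prod_decode z)"
abbreviation psnd :: "nat \<Rightarrow> nat" where "psnd z \<equiv> snd (prod_decode z)"

lemma computable_in_triangle: "computable_in X f \<Longrightarrow> computable_in X (\<lambda>n. triangle (f n))"
proof -
  have "computable_in X (rec_nat 0 (\<lambda>i r. Suc (i + r)))"
    unfolding computable2_def
    by (intro computable_in_rec_fun)
      (simp add: computable2_def computable_on_nth computable_on_Suc computable_on_app2[OF computable2_add])
  moreover have "rec_nat 0 (\<lambda>i r. Suc (i + r)) = triangle"
  proof
    show "rec_nat 0 (\<lambda>i r. Suc (i + r)) n = triangle n" for n by (induction n) auto
  qed
  ultimately have "computable_in X triangle" by simp
  then show "computable_in X f \<Longrightarrow> ?thesis" by (rule computable_in_app1)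
qed

text \<open>
  The index of the largest triangular number that does not exceed the argument.  It grows by at most one
  from each number to the next, which gives a primitive recursion whose state is a single number; for a
  pair it is the sum of the components, so both components can be computed from it.
\<close>

definition triangle_root :: "nat \<Rightarrow> nat" where
  "triangle_root = rec_nat 0 (\<lambda>i r. r + (1 - (triangle (Suc r) - Suc i)))"

lemma triangle_root_bounds: "triangle (triangle_root n) \<le> n \<and> n < triangle (Suc (triangle_root n))"
proof (induction n)
  case 0
  show ?case by (simp add: triangle_root_def)
next
  case (Suc n)
  have "triangle_root (Suc n) = (if triangle (Suc (triangle_root n)) \<le> Suc n
      then Suc (triangle_root n) else triangle_root n)"
    by (simp add: triangle_root_def)
  then show ?case using Suc by auto
qed

lemma triangle_mono: "m \<le> n \<Longrightarrow> triangle m \<le> triangle n"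
  by (induction n) (auto simp: le_Suc_eq)

lemma triangle_root_prod_encode: "triangle_root \<langle>a, b\<rangle> = a + b"
proof (rule antisym)
  note bounds = triangle_root_bounds[of "\<langle>a, b\<rangle>"]
  have p: "\<langle>a, b\<rangle> = triangle (a + b) + a" by (simp add: prod_encode_def)
  show "triangle_root \<langle>a, b\<rangle> \<le> a + b"
  proof (rule ccontr)
    assume "\<not> ?thesis"
    then have "triangle (Suc (a + b)) \<le> triangle (triangle_root \<langle>a, b\<rangle>)" by (intro triangle_mono) simp
    then show False using bounds p by simp
  qed
  show "a + b \<le> triangle_root \<langle>a, b\<rangle>"
  proof (rule ccontr)
    assume "\<not> ?thesis"
    then have "triangle (Suc (triangle_root \<langle>a, b\<rangle>)) \<le> triangle (a + b)" by (intro triangle_mono) simp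
    then show False using bounds p by simp
  qed
qed

lemma pfst_eq: "pfst z = z - triangle (triangle_root z)"
proof -
  obtain a b where z: "z = \<langle>a, b\<rangle>" by (metis prod_decode_inverse surj_pair)
  show ?thesis unfolding z triangle_root_prod_encode prod_encode_inverse by (simp add: prod_encode_def)
qed

lemma psnd_eq: "psnd z = triangle_root z - pfst z"
proof -
  obtain a b where z: "z = \<langle>a, b\<rangle>" by (metis prod_decode_inverse surj_pair)
  show ?thesis unfolding z triangle_root_prod_encode by simp
qed

lemma computable_in_triangle_root: "computable_in X triangle_root"
proof -
  have "computable2 X (\<lambda>i r. r + (1 - (triangle (Suc r) - Suc i)))"
    unfolding computable2_def
    by (intro computable_on_app2[OF computable2_add] computable_on_app2[OF computable2_diff]
        computable_on_app1[OF computable_in_triangle[OF computable_in_id]] computable_on_intros; simp)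
  then show ?thesis unfolding triangle_root_def by (rule computable_in_rec_fun)
qed

lemma computable_in_pfst [computable]: "computable_in X f \<Longrightarrow> computable_in X (\<lambda>n. pfst (f n))"
  unfolding pfst_eq
  by (intro computable_in_diff computable_in_triangle computable_in_app1[OF computable_in_triangle_root])

lemma computable_in_psnd [computable]: "computable_in X f \<Longrightarrow> computable_in X (\<lambda>n. psnd (f n))"
  unfolding psnd_eq
  by (intro computable_in_diff computable_in_pfst computable_in_app1[OF computable_in_triangle_root])

lemma computable_in_pair [computable]:
  "computable_in X f \<Longrightarrow> computable_in X g \<Longrightarrow> computable_in X (\<lambda>n. \<langle>f n, g n\<rangle>)"
  unfolding prod_encode_def case_prod_conv by (intro computable computable_in_triangle)

lemma computable2_uncurry: "computable2 X (\<lambda>a b. f \<langle>a, b\<rangle>)" if "computable_in X f"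
proof -
  have p: "computable2 X (\<lambda>a b. \<langle>a, b\<rangle>)"
  proof -
    have "computable2 X (\<lambda>a b. triangle (a + b) + a)" unfolding computable2_def
      by (intro computable_on_app2[OF computable2_add]
        computable_on_app1[OF computable_in_triangle[OF computable_in_id]] computable_on_intros; simp)
    then show ?thesis by (simp add: prod_encode_def)
  qed
  from computable_on_app1[OF that this[unfolded computable2_def]] show ?thesis
    by (simp add: computable2_def)
qed

lemma computable_in_rec [computable]:
  assumes s: "computable_in X (\<lambda>z. s (pfst (pfst z)) (psnd (pfst z)) (psnd z))"
    and b: "computable_in X b" and f: "computable_in X f"
  shows "computable_in X (\<lambda>n. rec_nat (b n) (\<lambda>i r. s i r n) (f n))"
proof -
  note p = computable2_uncurry[OF computable_in_id, of X]
  have "computable_on X 3 (\<lambda>xs. (\<lambda>z. s (pfst (pfst z)) (psnd (pfst z)) (psnd z)) \<langle>\<langle>xs ! 0, xs ! 1\<rangle>, xs ! 2\<rangle>)"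
    by (rule computable_on_app1[OF s]) (intro computable_on_app2[OF p] computable_on_nth; simp)
  then have "computable2 X (\<lambda>n x. rec_nat (b x) (\<lambda>i r. s i r x) n)"
    by (intro computable2_rec b) simp
  from computable_in_app2[OF this f computable_in_id] show ?thesis .
qed

lemma computable_in_Least_eq_0:
  assumes "computable_in X (\<lambda>z. f (pfst z) (psnd z))" and "\<And>n. \<exists>y. f n y = 0"
  shows "computable_in X (\<lambda>n. LEAST y. f n y = 0)"
proof -
  note p = computable2_uncurry[OF computable_in_id, of X]
  have "computable_on X 2 (\<lambda>xs. (\<lambda>z. f (pfst z) (psnd z)) \<langle>xs ! 1, xs ! 0\<rangle>)"
    by (rule computable_on_app1[OF assms(1)]) (intro computable_on_app2[OF p] computable_on_nth; simp)
  then have "computable_on X (Suc 1) (\<lambda>xs. f (xs ! 1) (xs ! 0))" by (simp add: numeral_2_eq_2)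
  from computable_on_Least[OF this] assms(2) show ?thesis by (simp add: computable_in_iff)
qed

lemma computable_in_mult [computable]:
  assumes "computable_in X f" "computable_in X g"
  shows "computable_in X (\<lambda>n. f n * g n)"
proof -
  have "computable_in X (\<lambda>n. rec_nat 0 (\<lambda>i r. r + g n) (f n))"
    by (intro computable assms(1) computable_in_app1[OF assms(2)])
  moreover have "rec_nat 0 (\<lambda>i r. r + b) a = a * b" for a b :: nat by (induction a) auto
  ultimately show ?thesis by simp
qed

lemma computable_in_power [computable]:
  assumes "computable_in X f" "computable_in X g"
  shows "computable_in X (\<lambda>n. f n ^ g n)"
proof -
  have "computable_in X (\<lambda>n. rec_nat 1 (\<lambda>i r. f n * r) (g n))"
    by (intro computable assms(2) computable_in_app1[OF assms(1)])
  moreover have "rec_nat 1 (\<lambda>i r. a * r) b = a ^ b" for a b :: nat by (induction b) auto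
  ultimately show ?thesis by simp
qed

section \<open>Decidable and semidecidable predicates\<close>

definition decidable_in :: "nat set \<Rightarrow> (nat \<Rightarrow> bool) \<Rightarrow> bool" where
  "decidable_in X P \<longleftrightarrow> computable_in X (\<lambda>n. of_bool (P n))"

lemma decidable_in_app: "decidable_in X P \<Longrightarrow> computable_in X f \<Longrightarrow> decidable_in X (\<lambda>n. P (f n))"
  unfolding decidable_in_def by (rule computable_in_app1)

lemma decidable_in_le [computable]:
  assumes "computable_in X f" "computable_in X g"
  shows "decidable_in X (\<lambda>n. f n \<le> g n)"
proof -
  have "computable_in X (\<lambda>n. 1 - (f n - g n))" by (intro computable assms)
  moreover have "of_bool (f n \<le> g n) = 1 - (f n - g n)" for n by auto
  ultimately show ?thesis by (simp add: decidable_in_def)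
qed

lemma decidable_in_not [computable]:
  assumes "decidable_in X P" shows "decidable_in X (\<lambda>n. \<not> P n)"
proof -
  have "computable_in X (\<lambda>n. 1 - of_bool (P n))" by (intro computable assms[unfolded decidable_in_def])
  moreover have "of_bool (\<not> P n) = (1 - of_bool (P n) :: nat)" for n by auto
  ultimately show ?thesis by (simp add: decidable_in_def)
qed

lemma decidable_in_conj [computable]:
  assumes "decidable_in X P" "decidable_in X Q" shows "decidable_in X (\<lambda>n. P n \<and> Q n)"
proof -
  have "computable_in X (\<lambda>n. of_bool (P n) * of_bool (Q n))"
    by (intro computable assms[unfolded decidable_in_def])
  then show ?thesis by (simp add: decidable_in_def of_bool_conj)
qed

lemma decidable_in_disj [computable]:
  assumes "decidable_in X P" "decidable_in X Q" shows "decidable_in X (\<lambda>n. P n \<or> Q n)"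
proof -
  have "decidable_in X (\<lambda>n. \<not> (\<not> P n \<and> \<not> Q n))" by (intro computable assms)
  then show ?thesis by simp
qed

lemma decidable_in_eq [computable]:
  assumes "computable_in X f" "computable_in X g"
  shows "decidable_in X (\<lambda>n. f n = g n)"
proof -
  have "decidable_in X (\<lambda>n. f n \<le> g n \<and> g n \<le> f n)" by (intro computable assms)
  then show ?thesis by (simp add: order_eq_iff)
qed

lemma decidable_in_less [computable]:
  assumes "computable_in X f" "computable_in X g"
  shows "decidable_in X (\<lambda>n. f n < g n)"
proof -
  have "decidable_in X (\<lambda>n. Suc (f n) \<le> g n)" by (intro computable assms)
  then show ?thesis by (simp add: Suc_le_eq)
qed

lemma decidable_in_bex [computable]:
  assumes P: "decidable_in X (\<lambda>z. P (pfst z) (psnd z))" and b: "computable_in X b"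
  shows "decidable_in X (\<lambda>n. \<exists>i<b n. P n i)"
proof -
  have "computable_in X (\<lambda>z. (\<lambda>z. of_bool (P (pfst z) (psnd z))) \<langle>psnd z, pfst (pfst z)\<rangle>)"
    using P unfolding decidable_in_def by (rule computable_in_app1) (intro computable)
  note step = this[simplified]
  have "decidable_in X (\<lambda>n. (0 :: nat) < rec_nat 0 (\<lambda>i r. r + of_bool (P n i)) (b n))"
    by (intro computable b step)
  moreover have "(0 :: nat) < rec_nat 0 (\<lambda>i r. r + of_bool (Q i)) m \<longleftrightarrow> (\<exists>i<m. Q i)" for m and Q :: "nat \<Rightarrow> bool"
    by (induction m) (auto simp: less_Suc_eq)
  ultimately show ?thesis by simp
qed

lemma decidable_in_ball [computable]:
  assumes P: "decidable_in X (\<lambda>z. P (pfst z) (psnd z))" and b: "computable_in X b"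
  shows "decidable_in X (\<lambda>n. \<forall>i<b n. P n i)"
proof -
  have "decidable_in X (\<lambda>n. \<not> (\<exists>i<b n. \<not> P n i))" by (intro computable assms)
  then show ?thesis by simp
qed

lemma computable_in_if [computable]:
  assumes "decidable_in X P" "computable_in X f" "computable_in X g"
  shows "computable_in X (\<lambda>n. if P n then f n else g n)"
proof -
  have "computable_in X (\<lambda>n. of_bool (P n) * f n + (1 - of_bool (P n)) * g n)"
    by (intro computable assms assms(1)[unfolded decidable_in_def])
  moreover have "(if P n then f n else g n) = of_bool (P n) * f n + (1 - of_bool (P n)) * g n" for n by auto
  ultimately show ?thesis by simp
qed

definition semidecidable_in :: "nat set \<Rightarrow> (nat \<Rightarrow> bool) \<Rightarrow> bool" where
  "semidecidable_in X P \<longleftrightarrow> (\<exists>Q. decidable_in X Q \<and> (\<forall>n. P n \<longleftrightarrow> (\<exists>y. Q \<langle>n, y\<rangle>)))"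

named_theorems semidecidable

lemma semidecidable_in_if_decidable: "decidable_in X P \<Longrightarrow> semidecidable_in X P"
  unfolding semidecidable_in_def
  by (intro exI[of _ "\<lambda>z. P (pfst z)"])
    (simp add: decidable_in_app[of X P pfst] computable_in_pfst[OF computable_in_id])

lemmas semidecidable_atoms [semidecidable] =
  semidecidable_in_if_decidable[OF decidable_in_eq]
  semidecidable_in_if_decidable[OF decidable_in_less]

lemma semidecidable_in_app:
  assumes "semidecidable_in X P" and f: "computable_in X f"
  shows "semidecidable_in X (\<lambda>n. P (f n))"
proof -
  obtain Q where Q: "decidable_in X Q" "\<forall>n. P n \<longleftrightarrow> (\<exists>y. Q \<langle>n, y\<rangle>)"
    using assms(1) unfolding semidecidable_in_def by blast
  have "decidable_in X (\<lambda>z. Q \<langle>f (pfst z), psnd z\<rangle>)"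
    by (intro decidable_in_app[OF Q(1)] computable computable_in_app1[OF f])
  with Q(2) show ?thesis
    unfolding semidecidable_in_def by (intro exI[of _ "\<lambda>z. Q \<langle>f (pfst z), psnd z\<rangle>"]) simp
qed

text \<open>
  Two existential quantifiers merge into one because a pair of witnesses is again a number.
\<close>

lemma semidecidable_in_ex [semidecidable]:
  assumes "semidecidable_in X (\<lambda>z. P (pfst z) (psnd z))"
  shows "semidecidable_in X (\<lambda>n. \<exists>y. P n y)"
proof -
  obtain Q where Q: "decidable_in X Q" "\<forall>z. P (pfst z) (psnd z) \<longleftrightarrow> (\<exists>y. Q \<langle>z, y\<rangle>)"
    using assms unfolding semidecidable_in_def by blast
  have "decidable_in X (\<lambda>z. Q \<langle>\<langle>pfst z, pfst (psnd z)\<rangle>, psnd (psnd z)\<rangle>)"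
    by (intro decidable_in_app[OF Q(1)] computable)
  moreover have "(\<exists>y. P n y) \<longleftrightarrow> (\<exists>w. Q \<langle>\<langle>n, pfst w\<rangle>, psnd w\<rangle>)" for n
    using Q(2)[rule_format, of "\<langle>n, _\<rangle>"] by simp (metis fst_conv prod_encode_inverse snd_conv)
  ultimately show ?thesis
    unfolding semidecidable_in_def
    by (intro exI[of _ "\<lambda>z. Q \<langle>\<langle>pfst z, pfst (psnd z)\<rangle>, psnd (psnd z)\<rangle>"]) simp
qed

lemma semidecidable_in_conj [semidecidable]:
  assumes "semidecidable_in X P" "semidecidable_in X P'"
  shows "semidecidable_in X (\<lambda>n. P n \<and> P' n)"
proof -
  obtain Q where Q: "decidable_in X Q" "\<forall>z. P z \<longleftrightarrow> (\<exists>y. Q \<langle>z, y\<rangle>)"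
    using assms(1) unfolding semidecidable_in_def by blast
  obtain Q' where Q': "decidable_in X Q'" "\<forall>z. P' z \<longleftrightarrow> (\<exists>y. Q' \<langle>z, y\<rangle>)"
    using assms(2) unfolding semidecidable_in_def by blast
  have "semidecidable_in X (\<lambda>n. \<exists>y y'. Q \<langle>n, y\<rangle> \<and> Q' \<langle>n, y'\<rangle>)"
    by (intro semidecidable_in_ex semidecidable_in_if_decidable decidable_in_conj
        decidable_in_app[OF Q(1)] decidable_in_app[OF Q'(1)] computable)
  then show ?thesis using Q(2) Q'(2) by simp
qed

lemma semidecidable_in_disj [semidecidable]:
  assumes "semidecidable_in X P" "semidecidable_in X P'"
  shows "semidecidable_in X (\<lambda>n. P n \<or> P' n)"
proof -
  obtain Q where Q: "decidable_in X Q" "\<forall>z. P z \<longleftrightarrow> (\<exists>y. Q \<langle>z, y\<rangle>)"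
    using assms(1) unfolding semidecidable_in_def by blast
  obtain Q' where Q': "decidable_in X Q'" "\<forall>z. P' z \<longleftrightarrow> (\<exists>y. Q' \<langle>z, y\<rangle>)"
    using assms(2) unfolding semidecidable_in_def by blast
  have "semidecidable_in X (\<lambda>n. \<exists>y. Q \<langle>n, y\<rangle> \<or> Q' \<langle>n, y\<rangle>)"
    by (intro semidecidable_in_ex semidecidable_in_if_decidable decidable_in_disj
        decidable_in_app[OF Q(1)] decidable_in_app[OF Q'(1)] computable)
  then show ?thesis using Q(2) Q'(2) by (simp add: ex_disj_distrib)
qed

text \<open>
  Finitely many witnesses have a common bound, so a bounded universal quantifier moves inwards without
  any coding of sequences.
\<close>

lemma semidecidable_in_ball [semidecidable]:
  assumes "semidecidable_in X (\<lambda>z. P (pfst z) (psnd z))" and b: "computable_in X b"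
  shows "semidecidable_in X (\<lambda>n. \<forall>i<b n. P n i)"
proof -
  obtain Q where Q: "decidable_in X Q" "\<forall>z. P (pfst z) (psnd z) \<longleftrightarrow> (\<exists>y. Q \<langle>z, y\<rangle>)"
    using assms(1) unfolding semidecidable_in_def by blast
  have P: "P n i \<longleftrightarrow> (\<exists>y. Q \<langle>\<langle>n, i\<rangle>, y\<rangle>)" for n i
    using Q(2)[rule_format, of "\<langle>n, i\<rangle>"] by simp
  have "semidecidable_in X (\<lambda>n. \<exists>Y. \<forall>i<b n. \<exists>y<Y. Q \<langle>\<langle>n, i\<rangle>, y\<rangle>)"
    by (intro semidecidable_in_ex semidecidable_in_if_decidable decidable_in_ball decidable_in_bex
        decidable_in_app[OF Q(1)] computable computable_in_app1[OF b])
  moreover have "(\<forall>i<b n. P n i) \<longleftrightarrow> (\<exists>Y. \<forall>i<b n. \<exists>y<Y. Q \<langle>\<langle>n, i\<rangle>, y\<rangle>)" for n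
  proof
    assume "\<forall>i<b n. P n i"
    then have "\<forall>i. \<exists>y. i < b n \<longrightarrow> Q \<langle>\<langle>n, i\<rangle>, y\<rangle>" using P by blast
    then obtain w where w: "\<And>i. i < b n \<Longrightarrow> Q \<langle>\<langle>n, i\<rangle>, w i\<rangle>" by metis
    have "\<forall>i<b n. w i < Suc (sum w {..<b n})" by (simp add: less_Suc_eq_le member_le_sum)
    then show "\<exists>Y. \<forall>i<b n. \<exists>y<Y. Q \<langle>\<langle>n, i\<rangle>, y\<rangle>" using w by blast
  qed (use P in blast)
  ultimately show ?thesis by simp
qed

text \<open>
  A total function is computed by searching for a value together with a witness that it is the right one.
  For characteristic functions this is Post's theorem: a set is decidable if it and its complement are
  semidecidable.
\<close>

lemma computable_in_if_semidecidable_graph: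
  assumes "semidecidable_in X (\<lambda>z. f (pfst z) = psnd z)"
  shows "computable_in X f"
proof -
  obtain Q where Q: "decidable_in X Q" "\<forall>z. f (pfst z) = psnd z \<longleftrightarrow> (\<exists>y. Q \<langle>z, y\<rangle>)"
    using assms unfolding semidecidable_in_def by blast
  have f: "f n = v \<longleftrightarrow> (\<exists>y. Q \<langle>\<langle>n, v\<rangle>, y\<rangle>)" for n v
    using Q(2)[rule_format, of "\<langle>n, v\<rangle>"] by simp
  \<comment> \<open>\<open>w\<close> codes a candidate value together with a witness; \<open>g\<close> vanishes on the successful ones.\<close>
  define g :: "nat \<Rightarrow> nat \<Rightarrow> nat" where "g n w = 1 - of_bool (Q \<langle>\<langle>n, pfst w\<rangle>, psnd w\<rangle>)" for n w
  have g0: "g n w = 0 \<longleftrightarrow> Q \<langle>\<langle>n, pfst w\<rangle>, psnd w\<rangle>" for n w by (simp add: g_def)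
  have ex: "\<exists>w. g n w = 0" for n
  proof -
    obtain y where "Q \<langle>\<langle>n, f n\<rangle>, y\<rangle>" using f by blast
    then have "g n \<langle>f n, y\<rangle> = 0" by (simp add: g0)
    then show ?thesis ..
  qed
  have "computable_in X (\<lambda>z. g (pfst z) (psnd z))"
    unfolding g_def
    by (intro computable decidable_in_app[OF Q(1), unfolded decidable_in_def])
  from computable_in_pfst[OF computable_in_Least_eq_0[OF this ex]]
  have "computable_in X (\<lambda>n. pfst (LEAST w. g n w = 0))" .
  moreover have "pfst (LEAST w. g n w = 0) = f n" for n
  proof -
    have "Q \<langle>\<langle>n, pfst (LEAST w. g n w = 0)\<rangle>, psnd (LEAST w. g n w = 0)\<rangle>"
      using LeastI_ex[OF ex[of n]] by (simp only: g0)
    then show ?thesis by (intro f[THEN iffD2, symmetric] exI)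
  qed
  ultimately show ?thesis by simp
qed

lemma decidable_in_set_decode [computable]:
  assumes "computable_in X f" "computable_in X g"
  shows "decidable_in X (\<lambda>n. f n \<in> set_decode (g n))"
proof -
  \<comment> \<open>The binary digit at position \<open>k\<close> is found by a bounded search for the digits above and below it.\<close>
  have "k \<in> set_decode d \<longleftrightarrow> (\<exists>a<Suc d. \<exists>b<2 ^ k. d = (2 * a + 1) * 2 ^ k + b)" for k d
  proof
    assume "k \<in> set_decode d"
    then obtain a where a: "d div 2 ^ k = 2 * a + 1" unfolding set_decode_def by (auto elim: oddE)
    have "d = d div 2 ^ k * 2 ^ k + d mod 2 ^ k" by (rule div_mult_mod_eq[symmetric])
    then have "d = (2 * a + 1) * 2 ^ k + d mod 2 ^ k" using a by metis
    moreover have "d mod 2 ^ k < 2 ^ k" by simp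
    moreover have "a < Suc d" using a div_le_dividend[of d "2 ^ k"] by linarith
    ultimately show "\<exists>a<Suc d. \<exists>b<2 ^ k. d = (2 * a + 1) * 2 ^ k + b" by blast
  next
    assume "\<exists>a<Suc d. \<exists>b<2 ^ k. d = (2 * a + 1) * 2 ^ k + b"
    then obtain a b where d: "d = (2 * a + 1) * 2 ^ k + b" "b < 2 ^ k" by blast
    have "d div 2 ^ k = (2 * a + 1) + b div 2 ^ k" unfolding d(1) by (rule div_mult_self3) simp
    then have "d div 2 ^ k = 2 * a + 1" using d(2) by simp
    then show "k \<in> set_decode d" by (simp add: set_decode_def)
  qed
  moreover have "decidable_in X (\<lambda>n. \<exists>a<Suc (g n). \<exists>b<2 ^ f n. g n = (2 * a + 1) * 2 ^ f n + b)"
    by (intro computable computable_in_app1[OF assms(1)] computable_in_app1[OF assms(2)])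
  ultimately show ?thesis by simp
qed

subsection \<open>Computability without an oracle\<close>

text \<open>
  The empty set answers every query with zero, so \<^const>\<open>Zero\<close> can stand in for \<^const>\<open>Query\<close>; the result
  no longer depends on the oracle.
\<close>

primrec query_to_zero :: "rexp \<Rightarrow> rexp" where
  "query_to_zero Zero = Zero"
| "query_to_zero Succ = Succ"
| "query_to_zero (Proj i) = Proj i"
| "query_to_zero Query = Zero"
| "query_to_zero (Comp f gs) = Comp (query_to_zero f) (map query_to_zero gs)"
| "query_to_zero (Prec f g) = Prec (query_to_zero f) (query_to_zero g)"
| "query_to_zero (Mu f) = Mu (query_to_zero f)"

lemma computes_query_to_zero: "computes {} e xs y \<Longrightarrow> computes X (query_to_zero e) xs y"
proof (induction rule: computes.induct)
  case (comp xs gs ys f z)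
  have "list_all2 (\<lambda>g y. computes X g xs y) (map query_to_zero gs) ys"
    using comp.IH(1) by (auto simp: list_all2_conv_all_nth)
  then show ?case using comp.IH(2) by (auto intro: computes.comp)
next
  case (prec_Suc f g n xs y z)
  then show ?case by (auto intro: computes.prec_Suc)
next
  case (mu f y xs)
  then show ?case by (auto intro!: computes.mu)
qed (auto intro: computes.intros)

lemma computable_in_mono: "computable_in {} f \<Longrightarrow> computable_in X f"
  unfolding computable_in_def using computes_query_to_zero by blast

lemma semidecidable_in_mono: "semidecidable_in {} P \<Longrightarrow> semidecidable_in X P"
  unfolding semidecidable_in_def decidable_in_def using computable_in_mono by blast

text \<open>
  A range is semidecidable by searching for a preimage. Conversely, a semidecidable set is
  enumerated by running through all pairs of a number and a possible witness, with a fixed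
  element of the set as the value at the unsuccessful pairs.
\<close>

lemma computably_enumerable_iff: "computably_enumerable W \<longleftrightarrow> semidecidable_in {} (\<lambda>n. n \<in> W)"
proof
  assume "computably_enumerable W"
  then consider "W = {}" | f where "computable_in {} f" "W = range f"
    unfolding computably_enumerable_def by blast
  then show "semidecidable_in {} (\<lambda>n. n \<in> W)"
  proof cases
    case 1
    have "semidecidable_in {} (\<lambda>n. n < 0)" by (intro semidecidable computable)
    with 1 show ?thesis by simp
  next
    case 2
    have "semidecidable_in {} (\<lambda>n. \<exists>y. n = f y)"
      by (intro semidecidable computable computable_in_app1[OF 2(1)])
    with 2 show ?thesis by (simp add: image_iff)
  qed
next
  assume "semidecidable_in {} (\<lambda>n. n \<in> W)"
  then obtain Q where Q: "decidable_in {} Q" "\<forall>n. n \<in> W \<longleftrightarrow> (\<exists>y. Q \<langle>n, y\<rangle>)"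
    unfolding semidecidable_in_def by blast
  show "computably_enumerable W"
  proof (cases "W = {}")
    case False
    then obtain a where a: "a \<in> W" by blast
    have "computable_in {} (\<lambda>z. if Q z then pfst z else a)"
      by (intro computable Q(1))
    moreover have "W = range (\<lambda>z. if Q z then pfst z else a)"
    proof
      show "W \<subseteq> range (\<lambda>z. if Q z then pfst z else a)"
      proof
        fix n assume "n \<in> W"
        then obtain y where "Q \<langle>n, y\<rangle>" using Q(2) by blast
        then show "n \<in> range (\<lambda>z. if Q z then pfst z else a)" by (intro image_eqI[of _ _ "\<langle>n, y\<rangle>"]) auto
      qed
      show "range (\<lambda>z. if Q z then pfst z else a) \<subseteq> W"
        using a Q(2) by auto (metis prod.collapse prod_decode_inverse)
    qed
    ultimately show ?thesis unfolding computably_enumerable_def by blast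
  qed (simp add: computably_enumerable_def)
qed

section \<open>Enumeration operators\<close>

text \<open>
  An enumeration operator, described by its action: it sends \<open>Y\<close> to \<open>{n. P Y n}\<close>. The second
  conjunct says that it is continuous, that is, monotone with every output depending on a finite
  part of the input; the first says that its values on finite sets are uniformly c.e. In this
  form the operators are closed under positive logical operations, so an operator can be written
  down as a formula in which the input occurs only positively.
\<close>

definition effective :: "(nat set \<Rightarrow> nat \<Rightarrow> bool) \<Rightarrow> bool" where
  "effective P \<longleftrightarrow> semidecidable_in {} (\<lambda>z. P (set_decode (psnd z)) (pfst z)) \<and>
     (\<forall>Y n. P Y n \<longleftrightarrow> (\<exists>D. finite D \<and> D \<subseteq> Y \<and> P D n))"

named_theorems effective_intros

lemma effective_semidecidable:
  "effective P \<Longrightarrow> semidecidable_in {} (\<lambda>z. P (set_decode (psnd z)) (pfst z))"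
  unfolding effective_def by (rule conjunct1)

lemma effective_iff_finite_use:
  "effective P \<Longrightarrow> P Y n \<longleftrightarrow> (\<exists>D. finite D \<and> D \<subseteq> Y \<and> P D n)"
  unfolding effective_def by (elim conjE allE[of _ Y] allE[of _ n])

lemmas effective_finite_use = effective_iff_finite_use[THEN iffD1]

lemma effective_mono:
  assumes "effective P" "P Y n" "Y \<subseteq> Z"
  shows "P Z n"
proof -
  obtain D where "finite D" "D \<subseteq> Y" "P D n" using effective_finite_use[OF assms(1,2)] by blast
  then have "\<exists>D. finite D \<and> D \<subseteq> Z \<and> P D n" using assms(3) by (intro exI[of _ D]) simp
  then show ?thesis by (rule effective_iff_finite_use[OF assms(1), THEN iffD2])
qed

lemma effectiveI:
  assumes "semidecidable_in {} (\<lambda>z. P (set_decode (psnd z)) (pfst z))"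
    and "\<And>Y Z n. P Y n \<Longrightarrow> Y \<subseteq> Z \<Longrightarrow> P Z n"
    and "\<And>Y n. P Y n \<Longrightarrow> \<exists>D. finite D \<and> D \<subseteq> Y \<and> P D n"
  shows "effective P"
  unfolding effective_def
proof (intro conjI assms(1) allI iffI)
  show "P Y n" if "\<exists>D. finite D \<and> D \<subseteq> Y \<and> P D n" for Y n
    using that assms(2)[of _ n Y] by blast
qed (rule assms(3))

lemma effective_of_semidecidable [effective_intros]:
  assumes "semidecidable_in {} P"
  shows "effective (\<lambda>Y. P)"
proof (rule effectiveI)
  show "semidecidable_in {} (\<lambda>z. P (pfst z))"
    by (intro semidecidable_in_app[OF assms] computable)
  show "\<exists>D. finite D \<and> D \<subseteq> Y \<and> P n" if "P n" for Y :: "nat set" and n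
    using that by (intro exI[of _ "{}"]) simp
qed

lemma effective_mem [effective_intros]:
  assumes "computable_in {} f"
  shows "effective (\<lambda>Y n. f n \<in> Y)"
proof (rule effectiveI)
  show "semidecidable_in {} (\<lambda>z. f (pfst z) \<in> set_decode (psnd z))"
    by (intro semidecidable_in_if_decidable computable computable_in_app1[OF assms])
  show "\<exists>D. finite D \<and> D \<subseteq> Y \<and> f n \<in> D" if "f n \<in> Y" for Y n
    using that by (intro exI[of _ "{f n}"]) simp
qed blast

lemma effective_app:
  assumes P: "effective P" and f: "computable_in {} f"
  shows "effective (\<lambda>Y n. P Y (f n))"
proof (rule effectiveI)
  have "semidecidable_in {} (\<lambda>z. (\<lambda>z. P (set_decode (psnd z)) (pfst z)) \<langle>f (pfst z), psnd z\<rangle>)"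
    by (rule semidecidable_in_app[OF effective_semidecidable[OF P]])
      (intro computable computable_in_app1[OF f])
  then show "semidecidable_in {} (\<lambda>z. P (set_decode (psnd z)) (f (pfst z)))" by simp
  show "P Z (f n)" if "P Y (f n)" "Y \<subseteq> Z" for Y Z n
    by (rule effective_mono[OF P that])
  show "\<exists>D. finite D \<and> D \<subseteq> Y \<and> P D (f n)" if "P Y (f n)" for Y n
    by (rule effective_finite_use[OF P that])
qed

lemma effective_conj [effective_intros]:
  assumes P: "effective P" and Q: "effective Q"
  shows "effective (\<lambda>Y n. P Y n \<and> Q Y n)"
proof (rule effectiveI)
  show "semidecidable_in {} (\<lambda>z. P (set_decode (psnd z)) (pfst z) \<and> Q (set_decode (psnd z)) (pfst z))"
    using P Q by (intro semidecidable effective_semidecidable)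
  show "\<exists>D. finite D \<and> D \<subseteq> Y \<and> P D n \<and> Q D n" if PQ: "P Y n \<and> Q Y n" for Y n
  proof -
    obtain D E where "finite D" "D \<subseteq> Y" "P D n" "finite E" "E \<subseteq> Y" "Q E n"
      using PQ effective_finite_use[OF P, of Y n] effective_finite_use[OF Q, of Y n] by blast
    then show ?thesis
      using effective_mono[OF P, of D n "D \<union> E"] effective_mono[OF Q, of E n "D \<union> E"]
      by (intro exI[of _ "D \<union> E"]) auto
  qed
  show "P Z n \<and> Q Z n" if "P Y n \<and> Q Y n" "Y \<subseteq> Z" for Y Z n
    using that effective_mono[OF P, of Y n Z] effective_mono[OF Q, of Y n Z] by blast
qed

lemma effective_disj [effective_intros]:
  assumes P: "effective P" and Q: "effective Q"
  shows "effective (\<lambda>Y n. P Y n \<or> Q Y n)"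
proof (rule effectiveI)
  show "semidecidable_in {} (\<lambda>z. P (set_decode (psnd z)) (pfst z) \<or> Q (set_decode (psnd z)) (pfst z))"
    using P Q by (intro semidecidable effective_semidecidable)
  show "\<exists>D. finite D \<and> D \<subseteq> Y \<and> (P D n \<or> Q D n)" if "P Y n \<or> Q Y n" for Y n
    using that effective_finite_use[OF P, of Y n] effective_finite_use[OF Q, of Y n] by blast
  show "P Z n \<or> Q Z n" if "P Y n \<or> Q Y n" "Y \<subseteq> Z" for Y Z n
    using that effective_mono[OF P, of Y n Z] effective_mono[OF Q, of Y n Z] by blast
qed

lemma effective_ex [effective_intros]:
  assumes P: "effective (\<lambda>Y z. P Y (pfst z) (psnd z))"
  shows "effective (\<lambda>Y n. \<exists>y. P Y n y)"
proof (rule effectiveI)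
  have "semidecidable_in {} (\<lambda>z. (\<lambda>z. P (set_decode (psnd z)) (pfst (pfst z)) (psnd (pfst z)))
      \<langle>\<langle>pfst (pfst z), psnd z\<rangle>, psnd (pfst z)\<rangle>)"
    by (rule semidecidable_in_app[OF effective_semidecidable[OF P]]) (intro computable)
  then have "semidecidable_in {} (\<lambda>z. P (set_decode (psnd (pfst z))) (pfst (pfst z)) (psnd z))" by simp
  then show "semidecidable_in {} (\<lambda>z. \<exists>y. P (set_decode (psnd z)) (pfst z) y)"
    by (rule semidecidable_in_ex)
  show "\<exists>D. finite D \<and> D \<subseteq> Y \<and> (\<exists>y. P D n y)" if ex: "\<exists>y. P Y n y" for Y n
  proof -
    obtain y where "P Y n y" using ex by blast
    with effective_finite_use[OF P, of Y "\<langle>n, y\<rangle>"] show ?thesis by auto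
  qed
  show "\<exists>y. P Z n y" if ex: "\<exists>y. P Y n y" and sub: "Y \<subseteq> Z" for Y Z n
  proof -
    obtain y where "P Y n y" using ex by blast
    with effective_mono[OF P, of Y "\<langle>n, y\<rangle>" Z] sub show ?thesis by auto
  qed
qed

lemma effective_ball [effective_intros]:
  assumes P: "effective (\<lambda>Y z. P Y (pfst z) (psnd z))" and b: "computable_in {} b"
  shows "effective (\<lambda>Y n. \<forall>i<b n. P Y n i)"
proof (rule effectiveI)
  have "semidecidable_in {} (\<lambda>z. (\<lambda>z. P (set_decode (psnd z)) (pfst (pfst z)) (psnd (pfst z)))
      \<langle>\<langle>pfst (pfst z), psnd z\<rangle>, psnd (pfst z)\<rangle>)"
    by (rule semidecidable_in_app[OF effective_semidecidable[OF P]]) (intro computable)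
  then have "semidecidable_in {} (\<lambda>z. P (set_decode (psnd (pfst z))) (pfst (pfst z)) (psnd z))" by simp
  then show "semidecidable_in {} (\<lambda>z. \<forall>i<b (pfst z). P (set_decode (psnd z)) (pfst z) i)"
    by (rule semidecidable_in_ball) (intro computable computable_in_app1[OF b])
  have mono: "P Z n i" if "P Y n i" "Y \<subseteq> Z" for Y Z n i
    using that effective_mono[OF P, of Y "\<langle>n, i\<rangle>" Z] by simp
  then show "\<forall>i<b n. P Z n i" if "\<forall>i<b n. P Y n i" "Y \<subseteq> Z" for Y Z n
    using that by blast
  show "\<exists>D. finite D \<and> D \<subseteq> Y \<and> (\<forall>i<b n. P D n i)" if "\<forall>i<b n. P Y n i" for Y n
  proof -
    have "\<exists>D. finite D \<and> D \<subseteq> Y \<and> P D n i" if "i < b n" for i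
      using that \<open>\<forall>i<b n. P Y n i\<close> effective_finite_use[OF P, of Y "\<langle>n, i\<rangle>"] by simp
    then obtain D where D: "\<And>i. i < b n \<Longrightarrow> finite (D i) \<and> D i \<subseteq> Y \<and> P (D i) n i" by metis
    have "\<forall>i<b n. P (\<Union>i<b n. D i) n i" using D mono by blast
    then show ?thesis using D by (intro exI[of _ "\<Union>i<b n. D i"]) auto
  qed
qed

lemma less_if_mem_set_decode:
  assumes "k \<in> set_decode d"
  shows "k < d"
proof (rule ccontr)
  assume "\<not> k < d"
  then have "d < 2 ^ k" using less_exp[of k] by linarith
  then show False using assms by (simp add: set_decode_def)
qed

text \<open>
  The quantifier over finite subsets of \<open>Y\<close> in a form to which the closure rules apply: the
  elements of the finite set with index \<open>d\<close> are smaller than \<open>d\<close>, so inclusion is a bounded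
  quantification.
\<close>

lemma effective_iff_finite_subset:
  assumes P: "effective P"
  shows "P Y n \<longleftrightarrow> (\<exists>d. P (set_decode d) n \<and> (\<forall>k<d. k \<notin> set_decode d \<or> k \<in> Y))"
proof
  assume "P Y n"
  then obtain D where D: "finite D" "D \<subseteq> Y" "P D n" using effective_finite_use[OF P] by blast
  then show "\<exists>d. P (set_decode d) n \<and> (\<forall>k<d. k \<notin> set_decode d \<or> k \<in> Y)"
    by (intro exI[of _ "set_encode D"]) auto
next
  assume "\<exists>d. P (set_decode d) n \<and> (\<forall>k<d. k \<notin> set_decode d \<or> k \<in> Y)"
  then obtain d where d: "P (set_decode d) n" "set_decode d \<subseteq> Y" using less_if_mem_set_decode by blast
  then show "P Y n" by (rule effective_mono[OF P])
qed

text \<open>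
  Applying an operator to semidecidable sets gives semidecidable sets: guess a finite part of
  the input that suffices, then verify that it is contained in the input. The input \<open>Z n\<close> may
  depend on the argument, which covers both a fixed input and the composition of two operators.
\<close>

lemma semidecidable_in_effective:
  assumes P: "effective P" and Z: "semidecidable_in X (\<lambda>z. psnd z \<in> Z (pfst z))"
    and f: "computable_in X f"
  shows "semidecidable_in X (\<lambda>n. P (Z n) (f n))"
proof -
  have "semidecidable_in X (\<lambda>z. (\<lambda>z. P (set_decode (psnd z)) (pfst z)) \<langle>f (pfst z), psnd z\<rangle>)"
    by (rule semidecidable_in_app[OF semidecidable_in_mono[OF effective_semidecidable[OF P]]])
      (intro computable computable_in_app1[OF f])
  moreover have "semidecidable_in X (\<lambda>z. (\<lambda>z. psnd z \<in> Z (pfst z)) \<langle>pfst (pfst z), psnd z\<rangle>)"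
    by (rule semidecidable_in_app[OF Z]) (intro computable)
  ultimately have "semidecidable_in X (\<lambda>n. \<exists>d. P (set_decode d) (f n) \<and>
      (\<forall>k<d. k \<notin> set_decode d \<or> k \<in> Z n))"
    by (intro semidecidable semidecidable_in_if_decidable[OF decidable_in_not] computable) simp_all
  moreover have "P (Z n) (f n) \<longleftrightarrow> (\<exists>d. P (set_decode d) (f n) \<and> (\<forall>k<d. k \<notin> set_decode d \<or> k \<in> Z n))" for n
    by (rule effective_iff_finite_subset[OF P])
  ultimately show ?thesis by (simp only:)
qed

lemma effective_comp:
  assumes P: "effective P" and Q: "effective Q"
  shows "effective (\<lambda>Y n. P {k. Q Y k} n)"
proof (rule effectiveI)
  have "semidecidable_in {} (\<lambda>z. (\<lambda>z. Q (set_decode (psnd z)) (pfst z)) \<langle>psnd z, psnd (pfst z)\<rangle>)"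
    by (rule semidecidable_in_app[OF effective_semidecidable[OF Q]]) (intro computable)
  then show "semidecidable_in {} (\<lambda>z. P {k. Q (set_decode (psnd z)) k} (pfst z))"
    by (intro semidecidable_in_effective[OF P] computable) simp
  show "P {k. Q Z k} n" if "P {k. Q Y k} n" "Y \<subseteq> Z" for Y Z n
    using effective_mono[OF P that(1)] effective_mono[OF Q _ that(2)] by blast
  show "\<exists>D. finite D \<and> D \<subseteq> Y \<and> P {k. Q D k} n" if PQ: "P {k. Q Y k} n" for Y n
  proof -
    obtain E where E: "finite E" "E \<subseteq> {k. Q Y k}" "P E n" using effective_finite_use[OF P PQ] by blast
    have "\<forall>k\<in>E. \<exists>D. finite D \<and> D \<subseteq> Y \<and> Q D k" using E(2) effective_finite_use[OF Q] by blast
    then obtain D where D: "\<And>k. k \<in> E \<Longrightarrow> finite (D k) \<and> D k \<subseteq> Y \<and> Q (D k) k" by metis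
    have "E \<subseteq> {k. Q (\<Union>k\<in>E. D k) k}" using D effective_mono[OF Q] by blast
    then have "P {k. Q (\<Union>k\<in>E. D k) k} n" using effective_mono[OF P E(3)] by blast
    then show ?thesis using D E(1) by (intro exI[of _ "\<Union>k\<in>E. D k"]) auto
  qed
qed

lemma mem_enum_op_iff:
  "n \<in> enum_op W Y \<longleftrightarrow> (\<exists>d. \<langle>n, d\<rangle> \<in> W \<and> (\<forall>k<d. k \<notin> set_decode d \<or> k \<in> Y))"
proof
  assume "n \<in> enum_op W Y"
  then obtain D where "finite D" "\<langle>n, set_encode D\<rangle> \<in> W" "D \<subseteq> Y" unfolding enum_op_def by blast
  then show "\<exists>d. \<langle>n, d\<rangle> \<in> W \<and> (\<forall>k<d. k \<notin> set_decode d \<or> k \<in> Y)"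
    by (intro exI[of _ "set_encode D"]) auto
next
  assume "\<exists>d. \<langle>n, d\<rangle> \<in> W \<and> (\<forall>k<d. k \<notin> set_decode d \<or> k \<in> Y)"
  then obtain d where "\<langle>n, d\<rangle> \<in> W" "set_decode d \<subseteq> Y" using less_if_mem_set_decode by blast
  then show "n \<in> enum_op W Y" unfolding enum_op_def by (auto intro!: exI[of _ "set_decode d"])
qed

lemma effective_enum_op:
  assumes "computably_enumerable W"
  shows "effective (\<lambda>Y n. n \<in> enum_op W Y)"
  unfolding mem_enum_op_iff using assms
  by (intro effective_intros semidecidable semidecidable_in_if_decidable[OF decidable_in_not]
      semidecidable_in_app[OF assms[unfolded computably_enumerable_iff]] computable)

text \<open>
  The axioms of the operator are all pairs of a number and a finite set that yields this number.
\<close>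

lemma effective_imp_enum_op:
  assumes P: "effective P"
  shows "\<exists>W. computably_enumerable W \<and> (\<forall>Y. enum_op W Y = {n. P Y n})"
proof (intro exI conjI allI)
  let ?W = "{z. P (set_decode (psnd z)) (pfst z)}"
  show "computably_enumerable ?W"
    using effective_semidecidable[OF P] by (simp add: computably_enumerable_iff)
  show "enum_op ?W Y = {n. P Y n}" for Y
  proof -
    have "n \<in> enum_op ?W Y \<longleftrightarrow> P Y n" for n
      unfolding mem_enum_op_iff effective_iff_finite_subset[OF P, of Y n] by simp
    then show ?thesis by (simp add: set_eq_iff)
  qed
qed

section \<open>Turing reducibility in terms of enumeration operators\<close>

text \<open>
  The graph contains the negative answers of an oracle as positive information, which is all
  that an enumeration operator can use.
\<close>

definition char_graph :: "nat set \<Rightarrow> nat set" where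
  "char_graph X = graph_codes (\<lambda>n. Some (indicator X n))"

lemma mem_char_graph [simp]: "\<langle>n, b\<rangle> \<in> char_graph X \<longleftrightarrow> b = indicator X n"
  by (auto simp: char_graph_def graph_codes_def)

lemma mem_char_graph_iff: "z \<in> char_graph X \<longleftrightarrow> psnd z = indicator X (pfst z)"
  using mem_char_graph[of "pfst z" "psnd z" X] by simp

lemma list_encode_eq_Suc_iff: "list_encode xs = Suc \<langle>x, c\<rangle> \<longleftrightarrow> (\<exists>ys. xs = x # ys \<and> c = list_encode ys)"
  by (cases xs) auto

lemma list_encode_eq_0_iff: "list_encode xs = 0 \<longleftrightarrow> xs = []"
  by (cases xs) auto

lemma ex_list_encode: "(\<exists>c. P c) \<longleftrightarrow> (\<exists>xs. P (list_encode xs))"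
proof
  assume "\<exists>c. P c"
  then obtain c where "P (list_encode (list_decode c))" by auto
  then show "\<exists>xs. P (list_encode xs)" ..
qed blast

lemma semidecidable_nth:
  "semidecidable_in X (\<lambda>z. \<exists>xs. pfst z = list_encode xs \<and> i < length xs \<and> psnd z = xs ! i)"
proof (induction i)
  case 0
  have "semidecidable_in X (\<lambda>z. \<exists>x c. pfst z = Suc \<langle>x, c\<rangle> \<and> psnd z = x)"
    by (intro semidecidable computable)
  moreover have "(\<exists>x c. pfst z = Suc \<langle>x, c\<rangle> \<and> psnd z = x) \<longleftrightarrow>
      (\<exists>xs. pfst z = list_encode xs \<and> 0 < length xs \<and> psnd z = xs ! 0)" (is "?L \<longleftrightarrow> ?R") for z
  proof
    assume ?L
    then obtain x xs where "pfst z = Suc \<langle>x, list_encode xs\<rangle>" "psnd z = x" by (auto simp: ex_list_encode)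
    then show ?R by (intro exI[of _ "x # xs"]) simp
  next
    assume ?R
    then obtain xs where "pfst z = list_encode xs" "0 < length xs" "psnd z = xs ! 0" by blast
    then show ?L by (cases xs) auto
  qed
  ultimately show ?case by simp
next
  case (Suc i)
  have "semidecidable_in X (\<lambda>z. \<exists>x c. pfst z = Suc \<langle>x, c\<rangle> \<and>
      (\<lambda>z. \<exists>xs. pfst z = list_encode xs \<and> i < length xs \<and> psnd z = xs ! i) \<langle>c, psnd z\<rangle>)"
    by (intro semidecidable semidecidable_in_app[OF Suc] computable)
  moreover have "(\<exists>x c. pfst z = Suc \<langle>x, c\<rangle> \<and>
      (\<lambda>z. \<exists>xs. pfst z = list_encode xs \<and> i < length xs \<and> psnd z = xs ! i) \<langle>c, psnd z\<rangle>) \<longleftrightarrow>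
      (\<exists>xs. pfst z = list_encode xs \<and> Suc i < length xs \<and> psnd z = xs ! Suc i)" (is "?L \<longleftrightarrow> ?R") for z
  proof
    assume ?L
    then obtain x xs where "pfst z = Suc \<langle>x, list_encode xs\<rangle>" "i < length xs" "psnd z = xs ! i" by auto
    then show ?R by (intro exI[of _ "x # xs"]) simp
  next
    assume ?R
    then obtain xs where "pfst z = list_encode xs" "Suc i < length xs" "psnd z = xs ! Suc i" by blast
    then show ?L by (cases xs) auto
  qed
  ultimately show ?case by simp
qed

text \<open>
  The entry at position \<open>i\<close> of the sequence \<open>x\<^sub>0, x\<^sub>1, \<dots>\<close> that is coded by the nested pairs
  \<open>\<langle>x\<^sub>0, \<langle>x\<^sub>1, \<dots>\<rangle>\<rangle>\<close>. No length is recorded: every number codes an infinite sequence, and every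
  finite sequence is an initial segment of one of them.
\<close>

definition seq_nth :: "nat \<Rightarrow> nat \<Rightarrow> nat" where
  "seq_nth c i = pfst (rec_nat c (\<lambda>_ r. psnd r) i)"

lemma computable_in_seq_nth [computable]:
  "computable_in X f \<Longrightarrow> computable_in X g \<Longrightarrow> computable_in X (\<lambda>n. seq_nth (f n) (g n))"
  unfolding seq_nth_def by (intro computable)

lemma seq_nth_0: "seq_nth \<langle>x, c\<rangle> 0 = x"
  by (simp add: seq_nth_def)

lemma seq_nth_Suc: "seq_nth \<langle>x, c\<rangle> (Suc i) = seq_nth c i"
proof -
  have "rec_nat \<langle>x, c\<rangle> (\<lambda>_ r. psnd r) (Suc i) = rec_nat c (\<lambda>_ r. psnd r) i" by (induction i) auto
  then show ?thesis by (simp add: seq_nth_def)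
qed

lemma ex_seq_code: "\<exists>c. \<forall>i\<le>n. seq_nth c i = s i"
proof (induction n arbitrary: s)
  case 0
  show ?case by (intro exI[of _ "\<langle>s 0, 0\<rangle>"]) (simp add: seq_nth_0)
next
  case (Suc n)
  obtain c where c: "\<forall>i\<le>n. seq_nth c i = s (Suc i)" using Suc[of "\<lambda>i. s (Suc i)"] by blast
  have "seq_nth \<langle>s 0, c\<rangle> i = s i" if "i \<le> Suc n" for i
    using that c by (cases i) (auto simp: seq_nth_0 seq_nth_Suc)
  then show ?case by blast
qed

inductive_simps computes_Zero_iff: "computes X Zero xs y"
inductive_simps computes_Succ_iff: "computes X Succ xs y"
inductive_simps computes_Proj_iff: "computes X (Proj i) xs y"
inductive_simps computes_Query_iff: "computes X Query xs y"
inductive_simps computes_Comp_iff: "computes X (Comp f gs) xs y"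
inductive_simps computes_Prec_Nil_iff: "computes X (Prec f g) [] y"
inductive_simps computes_Prec_0_iff: "computes X (Prec f g) (0 # xs) y"
inductive_simps computes_Prec_Suc_iff: "computes X (Prec f g) (Suc n # xs) y"
inductive_simps computes_Mu_iff: "computes X (Mu f) xs y"

text \<open>
  A terminating primitive recursion is witnessed by the sequence of its intermediate values.
\<close>

lemma computes_Prec_iff_seq:
  "computes X (Prec f g) (n # xs) y \<longleftrightarrow>
    (\<exists>c. computes X f xs (seq_nth c 0) \<and>
      (\<forall>i<n. computes X g (i # seq_nth c i # xs) (seq_nth c (Suc i))) \<and> y = seq_nth c n)"
proof -
  have "computes X (Prec f g) (n # xs) y \<longleftrightarrow>
    (\<exists>s. computes X f xs (s 0) \<and> (\<forall>i<n. computes X g (i # s i # xs) (s (Suc i))) \<and> y = s n)"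
  proof (induction n arbitrary: y)
    case 0
    show ?case by (auto simp: computes_Prec_0_iff)
  next
    case (Suc n)
    show ?case (is "?L \<longleftrightarrow> ?R")
    proof
      assume ?L
      then obtain s where s: "computes X f xs (s 0)" "\<forall>i<n. computes X g (i # s i # xs) (s (Suc i))"
        "computes X g (n # s n # xs) y"
        unfolding computes_Prec_Suc_iff Suc by blast
      then show ?R by (intro exI[of _ "s(Suc n := y)"]) (auto simp: less_Suc_eq)
    next
      assume ?R
      then obtain s where s: "computes X f xs (s 0)"
        "\<forall>i<Suc n. computes X g (i # s i # xs) (s (Suc i))" "y = s (Suc n)" by blast
      then have "computes X (Prec f g) (n # xs) (s n)" unfolding Suc by auto
      with s show ?L unfolding computes_Prec_Suc_iff by auto
    qed
  qed
  also have "\<dots> \<longleftrightarrow> (\<exists>c. computes X f xs (seq_nth c 0) \<and>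
      (\<forall>i<n. computes X g (i # seq_nth c i # xs) (seq_nth c (Suc i))) \<and> y = seq_nth c n)" (is "?L \<longleftrightarrow> ?R")
  proof
    assume ?L
    then obtain s where s: "computes X f xs (s 0)" "\<forall>i<n. computes X g (i # s i # xs) (s (Suc i))" "y = s n"
      by blast
    obtain c where "\<forall>i\<le>n. seq_nth c i = s i" using ex_seq_code by blast
    with s show ?R by (intro exI[of _ c]) (auto simp: Suc_leI)
  qed blast
  finally show ?thesis .
qed

text \<open>
  The case of \<^const>\<open>Comp\<close> below: the values of the inner functions are collected in a list.
\<close>

lemma computes_list_all2_effective:
  assumes "\<And>g. g \<in> set gs \<Longrightarrow> \<exists>P. effective P \<and>
    (\<forall>X xs y. P (char_graph X) \<langle>list_encode xs, y\<rangle> \<longleftrightarrow> computes X g xs y)"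
  shows "\<exists>L. effective L \<and> (\<forall>X xs ys. L (char_graph X) \<langle>list_encode xs, list_encode ys\<rangle> \<longleftrightarrow>
    list_all2 (\<lambda>g y. computes X g xs y) gs ys)"
  using assms
proof (induction gs)
  case Nil
  have "effective (\<lambda>Y z. psnd z = 0)" by (intro effective_intros semidecidable computable)
  then show ?case
    by (intro exI[of _ "\<lambda>Y z. psnd z = 0"]) (simp add: list_encode_eq_0_iff)
next
  case (Cons g gs)
  obtain P where P: "effective P" "\<And>X xs y. P (char_graph X) \<langle>list_encode xs, y\<rangle> \<longleftrightarrow> computes X g xs y"
    using Cons.prems[of g] by auto
  obtain L where L: "effective L" "\<And>X xs ys. L (char_graph X) \<langle>list_encode xs, list_encode ys\<rangle> \<longleftrightarrow>
    list_all2 (\<lambda>g y. computes X g xs y) gs ys"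
    using Cons by auto
  have "effective (\<lambda>Y z. \<exists>y c. psnd z = Suc \<langle>y, c\<rangle> \<and> P Y \<langle>pfst z, y\<rangle> \<and> L Y \<langle>pfst z, c\<rangle>)" (is "effective ?Q")
    by (intro effective_intros semidecidable computable effective_app[OF P(1)] effective_app[OF L(1)])
  moreover have "\<forall>X xs ys. ?Q (char_graph X) \<langle>list_encode xs, list_encode ys\<rangle> \<longleftrightarrow>
    list_all2 (\<lambda>g y. computes X g xs y) (g # gs) ys"
    by (auto simp: list_encode_eq_Suc_iff list_all2_Cons1 P(2) L(2))
  ultimately show ?case by (intro exI[of _ ?Q] conjI)
qed

text \<open>
  The halting computations of an expression form an enumeration operator, uniformly in the
  oracle. By recursion on the expression, the relation ``halts with value \<open>y\<close>'' is written as a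
  formula in which the oracle occurs only in the case of \<^const>\<open>Query\<close>, as a positive statement about
  its graph. The unbounded search of \<^const>\<open>Mu\<close> stays positive as well, because it requires the
  earlier values to exist and to be nonzero. Finite use of the oracle is then part of the
  closure properties.
\<close>

lemma computes_effective:
  "\<exists>P. effective P \<and> (\<forall>X xs y. P (char_graph X) \<langle>list_encode xs, y\<rangle> \<longleftrightarrow> computes X e xs y)"
proof (induction e)
  case Zero
  have "effective (\<lambda>Y z. psnd z = 0)" by (intro effective_intros semidecidable computable)
  then show ?case by (intro exI[of _ "\<lambda>Y z. psnd z = 0"]) (simp add: computes_Zero_iff)
next
  case Succ
  have "effective (\<lambda>Y z. \<exists>x. pfst z = Suc \<langle>x, 0\<rangle> \<and> psnd z = Suc x)" (is "effective ?Q")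
    by (intro effective_intros semidecidable computable)
  moreover have "\<forall>X xs y. ?Q (char_graph X) \<langle>list_encode xs, y\<rangle> \<longleftrightarrow> computes X Succ xs y"
    by (auto simp: computes_Succ_iff list_encode_eq_Suc_iff list_encode_eq_0_iff[unfolded eq_commute[of _ 0]])
  ultimately show ?case by (intro exI[of _ ?Q] conjI)
next
  case (Proj i)
  have "effective (\<lambda>Y z. \<exists>xs. pfst z = list_encode xs \<and> i < length xs \<and> psnd z = xs ! i)" (is "effective ?Q")
    by (intro effective_of_semidecidable semidecidable_nth)
  moreover have "\<forall>X xs y. ?Q (char_graph X) \<langle>list_encode xs, y\<rangle> \<longleftrightarrow> computes X (Proj i) xs y"
    by (auto simp: computes_Proj_iff list_encode_eq)
  ultimately show ?case by (intro exI[of _ ?Q] conjI)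
next
  case Query
  have "effective (\<lambda>Y z. \<exists>x. pfst z = Suc \<langle>x, 0\<rangle> \<and> \<langle>x, psnd z\<rangle> \<in> Y)" (is "effective ?Q")
    by (intro effective_intros semidecidable computable)
  moreover have "\<forall>X xs y. ?Q (char_graph X) \<langle>list_encode xs, y\<rangle> \<longleftrightarrow> computes X Query xs y"
    by (auto simp: computes_Query_iff list_encode_eq_Suc_iff list_encode_eq_0_iff[unfolded eq_commute[of _ 0]])
  ultimately show ?case by (intro exI[of _ ?Q] conjI)
next
  case (Comp f gs)
  obtain P where P: "effective P" "\<And>X xs y. P (char_graph X) \<langle>list_encode xs, y\<rangle> \<longleftrightarrow> computes X f xs y"
    using Comp.IH(1) by blast
  obtain L where L: "effective L" "\<And>X xs ys. L (char_graph X) \<langle>list_encode xs, list_encode ys\<rangle> \<longleftrightarrow>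
    list_all2 (\<lambda>g y. computes X g xs y) gs ys"
    using computes_list_all2_effective[OF Comp.IH(2)] by blast
  have "effective (\<lambda>Y z. \<exists>c. L Y \<langle>pfst z, c\<rangle> \<and> P Y \<langle>c, psnd z\<rangle>)" (is "effective ?Q")
    by (intro effective_intros computable effective_app[OF P(1)] effective_app[OF L(1)])
  moreover have "\<forall>X xs y. ?Q (char_graph X) \<langle>list_encode xs, y\<rangle> \<longleftrightarrow> computes X (Comp f gs) xs y"
    by (subst ex_list_encode) (simp add: computes_Comp_iff P(2) L(2))
  ultimately show ?case by (intro exI[of _ ?Q] conjI)
next
  case (Prec f g)
  obtain P where P: "effective P" "\<And>X xs y. P (char_graph X) \<langle>list_encode xs, y\<rangle> \<longleftrightarrow> computes X f xs y"
    using Prec.IH(1) by blast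
  obtain R where R: "effective R" "\<And>X xs y. R (char_graph X) \<langle>list_encode xs, y\<rangle> \<longleftrightarrow> computes X g xs y"
    using Prec.IH(2) by blast
  have R': "R (char_graph X) \<langle>Suc \<langle>i, Suc \<langle>r, list_encode xs\<rangle>\<rangle>, y\<rangle> \<longleftrightarrow> computes X g (i # r # xs) y"
    for X i r xs y
    using R(2)[of X "i # r # xs" y] by simp
  have "effective (\<lambda>Y z. \<exists>n a c. pfst z = Suc \<langle>n, a\<rangle> \<and> P Y \<langle>a, seq_nth c 0\<rangle> \<and>
      (\<forall>i<n. R Y \<langle>Suc \<langle>i, Suc \<langle>seq_nth c i, a\<rangle>\<rangle>, seq_nth c (Suc i)\<rangle>) \<and> psnd z = seq_nth c n)"
    (is "effective ?Q")
    by (intro effective_intros semidecidable computable effective_app[OF P(1)] effective_app[OF R(1)])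
  moreover have "\<forall>X xs y. ?Q (char_graph X) \<langle>list_encode xs, y\<rangle> \<longleftrightarrow> computes X (Prec f g) xs y"
  proof (intro allI)
    fix X xs y
    show "?Q (char_graph X) \<langle>list_encode xs, y\<rangle> \<longleftrightarrow> computes X (Prec f g) xs y"
    proof (cases xs)
      case Nil
      then show ?thesis by (simp add: computes_Prec_Nil_iff)
    next
      case (Cons n ys)
      then show ?thesis by (simp add: computes_Prec_iff_seq P(2) R')
    qed
  qed
  ultimately show ?case by (intro exI[of _ ?Q] conjI)
next
  case (Mu f)
  obtain P where P: "effective P" "\<And>X xs y. P (char_graph X) \<langle>list_encode xs, y\<rangle> \<longleftrightarrow> computes X f xs y"
    using Mu.IH by blast
  have P': "P (char_graph X) \<langle>Suc \<langle>i, list_encode xs\<rangle>, y\<rangle> \<longleftrightarrow> computes X f (i # xs) y" for X i xs y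
    using P(2)[of X "i # xs" y] by simp
  have "effective (\<lambda>Y z. P Y \<langle>Suc \<langle>psnd z, pfst z\<rangle>, 0\<rangle> \<and>
      (\<forall>i<psnd z. \<exists>v. P Y \<langle>Suc \<langle>i, pfst z\<rangle>, Suc v\<rangle>))" (is "effective ?Q")
    by (intro effective_intros computable effective_app[OF P(1)])
  moreover have "\<forall>X xs y. ?Q (char_graph X) \<langle>list_encode xs, y\<rangle> \<longleftrightarrow> computes X (Mu f) xs y"
    by (simp add: computes_Mu_iff P')
  ultimately show ?case by (intro exI[of _ ?Q] conjI)
qed

text \<open>
  Turing reducibility is enumeration reducibility of graphs of characteristic functions: a
  computation from \<open>B\<close> is an operator by the preceding lemma, and conversely the graph of \<open>B\<close> is
  decidable in \<open>B\<close>, so an operator makes the graph of \<open>A\<close> semidecidable in \<open>B\<close>, which suffices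
  as the characteristic function of \<open>A\<close> is total.
\<close>

lemma turing_reducible_iff_effective:
  "A \<le>\<^sub>T B \<longleftrightarrow> (\<exists>P. effective P \<and> {n. P (char_graph B) n} = char_graph A)"
proof
  assume "A \<le>\<^sub>T B"
  then obtain e where e: "\<And>n. computes B e [n] (indicator A n)"
    unfolding turing_reducible_def computable_in_def by blast
  obtain P where P: "effective P" "\<And>X xs y. P (char_graph X) \<langle>list_encode xs, y\<rangle> \<longleftrightarrow> computes X e xs y"
    using computes_effective by blast
  have "effective (\<lambda>Y z. P Y \<langle>Suc \<langle>pfst z, 0\<rangle>, psnd z\<rangle>)"
    by (intro computable effective_app[OF P(1)])
  moreover have "P (char_graph B) \<langle>Suc \<langle>n, 0\<rangle>, y\<rangle> \<longleftrightarrow> y = indicator A n" for n y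
    using P(2)[of B "[n]" y] e[of n] computes_deterministic by auto
  ultimately show "\<exists>P. effective P \<and> {n. P (char_graph B) n} = char_graph A"
    by (intro exI[of _ "\<lambda>Y z. P Y \<langle>Suc \<langle>pfst z, 0\<rangle>, psnd z\<rangle>"]) (auto simp: mem_char_graph_iff)
next
  assume "\<exists>P. effective P \<and> {n. P (char_graph B) n} = char_graph A"
  then obtain P where P: "effective P" "{n. P (char_graph B) n} = char_graph A" by blast
  have "semidecidable_in B (\<lambda>z. psnd z \<in> char_graph B)"
    unfolding mem_char_graph_iff by (intro semidecidable computable)
  then have "semidecidable_in B (\<lambda>z. P (char_graph B) z)"
    by (intro semidecidable_in_effective[OF P(1)] computable)
  then have "semidecidable_in B (\<lambda>z. indicator A (pfst z) = psnd z)"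
    using P(2) by (simp add: set_eq_iff mem_char_graph_iff eq_commute)
  then show "A \<le>\<^sub>T B"
    unfolding turing_reducible_def by (rule computable_in_if_semidecidable_graph)
qed

lemma turing_reducible_refl: "A \<le>\<^sub>T A"
  unfolding turing_reducible_iff_effective
  by (intro exI[of _ "\<lambda>Y n. n \<in> Y"] conjI effective_mem computable) simp

lemma turing_reducible_trans:
  assumes "A \<le>\<^sub>T B" "B \<le>\<^sub>T C"
  shows "A \<le>\<^sub>T C"
proof -
  obtain P where P: "effective P" "{n. P (char_graph B) n} = char_graph A"
    using assms(1) unfolding turing_reducible_iff_effective by blast
  obtain Q where Q: "effective Q" "{n. Q (char_graph C) n} = char_graph B"
    using assms(2) unfolding turing_reducible_iff_effective by blast
  show ?thesis unfolding turing_reducible_iff_effective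
    by (intro exI[of _ "\<lambda>Y n. P {k. Q Y k} n"] conjI effective_comp P(1) Q(1)) (simp only: P(2) Q(2))
qed

section \<open>Generic reducibility\<close>

lemma generic_reducible_iff_effective:
  "A \<le>\<^sub>g B \<longleftrightarrow> (\<exists>P. effective P \<and> (\<forall>\<Psi>. generic_description \<Psi> B \<longrightarrow>
     (\<exists>\<Theta>. generic_description \<Theta> A \<and> {n. P (graph_codes \<Psi>) n} = graph_codes \<Theta>)))"
proof
  assume "A \<le>\<^sub>g B"
  then obtain W where W: "computably_enumerable W" "\<And>\<Psi>. generic_description \<Psi> B \<Longrightarrow>
      \<exists>\<Theta>. generic_description \<Theta> A \<and> enum_op W (graph_codes \<Psi>) = graph_codes \<Theta>"
    unfolding generic_reducible_def by blast
  show "\<exists>P. effective P \<and> (\<forall>\<Psi>. generic_description \<Psi> B \<longrightarrow>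
     (\<exists>\<Theta>. generic_description \<Theta> A \<and> {n. P (graph_codes \<Psi>) n} = graph_codes \<Theta>))"
    using W(2) by (intro exI[of _ "\<lambda>Y n. n \<in> enum_op W Y"] conjI effective_enum_op[OF W(1)]) simp
next
  assume "\<exists>P. effective P \<and> (\<forall>\<Psi>. generic_description \<Psi> B \<longrightarrow>
     (\<exists>\<Theta>. generic_description \<Theta> A \<and> {n. P (graph_codes \<Psi>) n} = graph_codes \<Theta>))"
  then obtain P where P: "effective P" "\<And>\<Psi>. generic_description \<Psi> B \<Longrightarrow>
      \<exists>\<Theta>. generic_description \<Theta> A \<and> {n. P (graph_codes \<Psi>) n} = graph_codes \<Theta>"
    by blast
  obtain W where W: "computably_enumerable W" "\<And>Y. enum_op W Y = {n. P Y n}"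
    using effective_imp_enum_op[OF P(1)] by blast
  show "A \<le>\<^sub>g B"
    unfolding generic_reducible_def using W(1) P(2) by (intro exI[of _ W]) (simp add: W(2))
qed

lemma generic_reducible_refl: "A \<le>\<^sub>g A"
  unfolding generic_reducible_iff_effective
  by (intro exI[of _ "\<lambda>Y n. n \<in> Y"] conjI effective_mem computable) auto

lemma generic_reducible_trans:
  assumes "A \<le>\<^sub>g B" "B \<le>\<^sub>g C"
  shows "A \<le>\<^sub>g C"
proof -
  obtain P where P: "effective P" "\<And>\<Psi>. generic_description \<Psi> B \<Longrightarrow>
      \<exists>\<Theta>. generic_description \<Theta> A \<and> {n. P (graph_codes \<Psi>) n} = graph_codes \<Theta>"
    using assms(1) unfolding generic_reducible_iff_effective by blast
  obtain Q where Q: "effective Q" "\<And>\<Psi>. generic_description \<Psi> C \<Longrightarrow>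
      \<exists>\<Theta>. generic_description \<Theta> B \<and> {n. Q (graph_codes \<Psi>) n} = graph_codes \<Theta>"
    using assms(2) unfolding generic_reducible_iff_effective by blast
  have "\<exists>\<Theta>. generic_description \<Theta> A \<and> {n. P {k. Q (graph_codes \<Psi>) k} n} = graph_codes \<Theta>"
    if \<Psi>: "generic_description \<Psi> C" for \<Psi>
  proof -
    obtain \<Xi> where \<Xi>: "generic_description \<Xi> B" "{n. Q (graph_codes \<Psi>) n} = graph_codes \<Xi>"
      using Q(2)[OF \<Psi>] by blast
    show ?thesis unfolding \<Xi>(2) by (rule P(2)[OF \<Xi>(1)])
  qed
  then show ?thesis unfolding generic_reducible_iff_effective
    by (intro exI[of _ "\<lambda>Y n. P {k. Q Y k} n"] conjI effective_comp P(1) Q(1)) simp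
qed

section \<open>The layers and their density\<close>

lemma R_layer_iff: "m \<in> R_layer k \<longleftrightarrow> (\<exists>q. m = (2 * q + 1) * 2 ^ k)"
proof
  assume m: "m \<in> R_layer k"
  then obtain a where a: "m = 2 ^ k * a" unfolding R_layer_def by auto
  have "odd a" using m unfolding R_layer_def a by (auto simp: mult.commute)
  then show "\<exists>q. m = (2 * q + 1) * 2 ^ k" unfolding a by (auto elim!: oddE)
next
  assume "\<exists>q. m = (2 * q + 1) * 2 ^ k"
  then obtain q where q: "m = 2 ^ k * (2 * q + 1)" by (auto simp: mult.commute)
  have "\<not> 2 ^ (k + 1) dvd m"
  proof
    assume "2 ^ (k + 1) dvd m"
    then have "2 ^ k * 2 dvd 2 ^ k * (2 * q + 1)" unfolding q by (simp add: mult.commute)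
    then have "2 dvd 2 * q + 1" unfolding nat_mult_dvd_cancel_disj by simp
    then show False by simp
  qed
  then show "m \<in> R_layer k" unfolding R_layer_def by (simp add: q)
qed

lemma R_layer_unique:
  assumes "m \<in> R_layer j" "m \<in> R_layer k"
  shows "j = k"
proof -
  have "j \<le> k" if "m \<in> R_layer j" "m \<in> R_layer k" for j k
  proof (rule ccontr)
    assume "\<not> j \<le> k"
    then have "2 ^ (k + 1) dvd (2 ^ j :: nat)" by (intro le_imp_power_dvd) simp
    then show False using that dvd_trans unfolding R_layer_def by blast
  qed
  then show ?thesis using assms by (meson antisym)
qed

lemma ex_R_layer:
  assumes "0 < m"
  shows "\<exists>k. m \<in> R_layer k"
  using assms
proof (induction m rule: less_induct)
  case (less m)
  show ?case
  proof (cases "even m")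
    case True
    then obtain l where l: "m = 2 * l" by (auto elim: evenE)
    then obtain k q where "l = (2 * q + 1) * 2 ^ k"
      using less.IH[of l] less.prems unfolding R_layer_iff by auto
    then have "m = (2 * q + 1) * 2 ^ Suc k" using l by simp
    then show ?thesis unfolding R_layer_iff by blast
  next
    case False
    then obtain q where "m = (2 * q + 1) * 2 ^ 0" by (auto elim: oddE)
    then show ?thesis unfolding R_layer_iff by blast
  qed
qed

lemma indicator_R_set: "m \<in> R_layer k \<Longrightarrow> indicator (R_set A) m = (indicator A k :: nat)"
  unfolding R_set_def indicator_def using R_layer_unique by auto

lemma zero_notin_R_set: "0 \<notin> R_set A"
  unfolding R_set_def by (simp add: R_layer_def)

lemma semidecidable_R_layer [semidecidable]:
  assumes "computable_in X f" "computable_in X g"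
  shows "semidecidable_in X (\<lambda>n. f n \<in> R_layer (g n))"
  unfolding R_layer_iff
  by (intro semidecidable computable computable_in_app1[OF assms(1)] computable_in_app1[OF assms(2)])

text \<open>
  A layer contains one number from every block of length \<open>2 ^ (k + 1)\<close>, so a set that misses it
  fills at most the fraction \<open>1 - 1 / 2 ^ (k + 1)\<close> of each initial segment made of such blocks.
\<close>

lemma meets_R_layer_if_density_1:
  assumes "has_density S 1"
  shows "S \<inter> R_layer k \<noteq> {}"
proof
  assume disj: "S \<inter> R_layer k = {}"
  let ?ratio = "\<lambda>n. real (card (S \<inter> {0..n})) / real (n + 1)"
  \<comment> \<open>\<open>{0..r t}\<close> consists of exactly \<open>t + 1\<close> blocks.\<close>
  define r where "r t = 2 ^ (k + 1) * Suc t - 1" for t :: nat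
  have Suc_r: "Suc (r t) = 2 ^ (k + 1) * Suc t" for t
    by (simp add: r_def)
  have bound: "?ratio (r t) \<le> 1 - 1 / 2 ^ (k + 1)" for t
  proof -
    \<comment> \<open>The element of the layer in block number \<open>q\<close>.\<close>
    let ?h = "\<lambda>q. (2 * q + 1) * 2 ^ k :: nat"
    have h: "?h ` {..t} \<subseteq> {0..r t}"
    proof
      fix m assume "m \<in> ?h ` {..t}"
      then obtain q where q: "m = ?h q" "q \<le> t" by blast
      have "m < 2 ^ (k + 1) * Suc q" unfolding q(1) by (simp add: algebra_simps)
      also have "\<dots> \<le> Suc (r t)" unfolding Suc_r using q(2) by (intro mult_left_mono) auto
      finally show "m \<in> {0..r t}" by simp
    qed
    have "inj_on ?h {..t}" by (auto simp: inj_on_def)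
    then have card_h: "card (?h ` {..t}) = Suc t" by (simp add: card_image)
    have "(S \<inter> {0..r t}) \<inter> ?h ` {..t} = {}" using disj R_layer_iff by blast
    then have "card (S \<inter> {0..r t}) + card (?h ` {..t}) = card ((S \<inter> {0..r t}) \<union> ?h ` {..t})"
      by (intro card_Un_disjoint[symmetric]) auto
    also have "\<dots> \<le> card {0..r t}" using h by (intro card_mono) auto
    finally have "card (S \<inter> {0..r t}) + Suc t \<le> 2 ^ (k + 1) * Suc t"
      using card_h Suc_r[of t] by simp
    then have "real (card (S \<inter> {0..r t}) + Suc t) \<le> real (2 ^ (k + 1) * Suc t)" by (rule of_nat_mono)
    then have le: "real (card (S \<inter> {0..r t})) \<le> 2 ^ (k + 1) * real (Suc t) - real (Suc t)"
      by (simp only: of_nat_add of_nat_mult of_nat_power of_nat_numeral)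
    have "real (r t + 1) = 2 ^ (k + 1) * real (Suc t)"
      using arg_cong[OF Suc_r[of t], of real]
      by (simp only: Suc_eq_plus1 of_nat_mult of_nat_power of_nat_numeral)
    then have "?ratio (r t) = real (card (S \<inter> {0..r t})) / (2 ^ (k + 1) * real (Suc t))" by simp
    also have "\<dots> \<le> (2 ^ (k + 1) * real (Suc t) - real (Suc t)) / (2 ^ (k + 1) * real (Suc t))"
      using le by (intro divide_right_mono) simp_all
    also have "\<dots> = 1 - 1 / 2 ^ (k + 1)" by (simp add: diff_divide_distrib)
    finally show ?thesis .
  qed
  have lim: "(?ratio \<circ> r) \<longlonglongrightarrow> 1"
  proof (rule LIMSEQ_subseq_LIMSEQ)
    show "?ratio \<longlonglongrightarrow> 1" using assms unfolding has_density_def .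
    show "strict_mono r"
      unfolding strict_mono_Suc_iff
    proof
      have "Suc (r t) < Suc (r (Suc t))" for t unfolding Suc_r by simp
      then show "r t < r (Suc t)" for t by blast
    qed
  qed
  have "(1 :: real) \<le> 1 - 1 / 2 ^ (k + 1)"
    by (rule LIMSEQ_le_const2[OF lim]) (use bound in \<open>simp only: o_apply, blast\<close>)
  moreover have "(0 :: real) < 1 / 2 ^ (k + 1)" by simp
  ultimately show False by linarith
qed

lemma generic_description_total: "generic_description (\<lambda>n. Some (indicator A n)) A"
proof -
  have "(\<lambda>n. real (card (UNIV \<inter> {0..n})) / real (n + 1)) = (\<lambda>n. 1)" by (intro ext) simp
  then have "has_density UNIV 1" unfolding has_density_def by simp
  then show ?thesis by (simp add: generic_description_def dom_def)
qed

section \<open>Coding a set into the layers\<close>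

text \<open>
  The operators \<open>spread\<close> and \<open>collapse\<close> translate between the graph of \<open>A\<close> and graphs of generic
  descriptions of \<^term>\<open>R_set A\<close>. The number \<open>0\<close> lies in no layer, so \<open>spread\<close> has to add its value
  \<open>0\<close> separately.
\<close>

definition spread :: "nat set \<Rightarrow> nat \<Rightarrow> bool" where
  "spread Y z \<longleftrightarrow> (pfst z = 0 \<and> psnd z = 0) \<or> (\<exists>k. pfst z \<in> R_layer k \<and> \<langle>k, psnd z\<rangle> \<in> Y)"

definition collapse :: "nat set \<Rightarrow> nat \<Rightarrow> bool" where
  "collapse Y z \<longleftrightarrow> (\<exists>m. m \<in> R_layer (pfst z) \<and> \<langle>m, psnd z\<rangle> \<in> Y)"

lemma effective_spread: "effective spread"
  unfolding spread_def[abs_def] by (intro effective_intros semidecidable computable)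

lemma effective_collapse: "effective collapse"
  unfolding collapse_def[abs_def] by (intro effective_intros semidecidable computable)

lemma spread_char_graph: "{z. spread (char_graph A) z} = char_graph (R_set A)"
proof -
  have "spread (char_graph A) z \<longleftrightarrow> psnd z = indicator (R_set A) (pfst z)" for z
  proof (cases "pfst z = 0")
    case True
    then show ?thesis by (simp add: spread_def R_layer_def zero_notin_R_set)
  next
    case False
    then obtain k where k: "pfst z \<in> R_layer k" using ex_R_layer by blast
    then have "spread (char_graph A) z \<longleftrightarrow> psnd z = indicator A k"
      unfolding spread_def using False R_layer_unique by auto
    then show ?thesis using indicator_R_set[OF k] by simp
  qed
  then show ?thesis by (simp add: set_eq_iff mem_char_graph_iff)
qed

text \<open>
  One element of each layer in the domain suffices to recover \<open>A\<close>, and all of them give the same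
  answer since \<^term>\<open>R_set A\<close> contains all or nothing of a layer.
\<close>

lemma collapse_generic_description:
  assumes "generic_description \<Psi> (R_set A)"
  shows "{z. collapse (graph_codes \<Psi>) z} = char_graph A"
proof -
  have val: "\<langle>m, b\<rangle> \<in> graph_codes \<Psi> \<longleftrightarrow> m \<in> dom \<Psi> \<and> b = indicator (R_set A) m" for m b
  proof -
    have "\<Psi> m = Some (indicator (R_set A) m)" if "m \<in> dom \<Psi>"
      using assms that by (simp add: generic_description_def)
    then have "\<Psi> m = Some b \<longleftrightarrow> m \<in> dom \<Psi> \<and> b = indicator (R_set A) m"
      by (cases "\<Psi> m") (simp_all add: domIff eq_commute[of b])
    then show ?thesis by (simp add: graph_codes_def)
  qed
  have "collapse (graph_codes \<Psi>) z \<longleftrightarrow> psnd z = indicator A (pfst z)" for z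
  proof -
    have "dom \<Psi> \<inter> R_layer (pfst z) \<noteq> {}"
      using assms by (intro meets_R_layer_if_density_1) (simp add: generic_description_def)
    then obtain m where "m \<in> R_layer (pfst z)" "m \<in> dom \<Psi>" by blast
    then show ?thesis
      unfolding collapse_def val using indicator_R_set[of _ "pfst z" A] by metis
  qed
  then show ?thesis by (simp add: set_eq_iff mem_char_graph_iff)
qed

text \<open>
  A generic reduction is sandwiched between \<open>spread\<close> and \<open>collapse\<close> to give an operator on
  graphs; an operator on graphs is sandwiched between \<open>collapse\<close> and \<open>spread\<close> to give a generic
  reduction, which even produces total descriptions.
\<close>

lemma R_set_generic_reducible_iff: "R_set A \<le>\<^sub>g R_set B \<longleftrightarrow> A \<le>\<^sub>T B"
proof
  assume "R_set A \<le>\<^sub>g R_set B"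
  then obtain P where P: "effective P" "\<And>\<Psi>. generic_description \<Psi> (R_set B) \<Longrightarrow>
      \<exists>\<Theta>. generic_description \<Theta> (R_set A) \<and> {n. P (graph_codes \<Psi>) n} = graph_codes \<Theta>"
    unfolding generic_reducible_iff_effective by blast
  obtain \<Theta> where \<Theta>: "generic_description \<Theta> (R_set A)"
    "{n. P (char_graph (R_set B)) n} = graph_codes \<Theta>"
    using P(2)[OF generic_description_total] unfolding char_graph_def by blast
  have "effective (\<lambda>Y. collapse {n. P {z. spread Y z} n})"
    by (rule effective_comp[OF effective_collapse effective_comp[OF P(1) effective_spread]])
  moreover have "{z. collapse {n. P {z. spread (char_graph B) z} n} z} = char_graph A"
    unfolding spread_char_graph \<Theta>(2) by (rule collapse_generic_description[OF \<Theta>(1)])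
  ultimately show "A \<le>\<^sub>T B"
    unfolding turing_reducible_iff_effective
    by (intro exI[of _ "\<lambda>Y. collapse {n. P {z. spread Y z} n}"] conjI)
next
  assume "A \<le>\<^sub>T B"
  then obtain P where P: "effective P" "{n. P (char_graph B) n} = char_graph A"
    unfolding turing_reducible_iff_effective by blast
  have eff: "effective (\<lambda>Y. spread {n. P {z. collapse Y z} n})"
    by (rule effective_comp[OF effective_spread effective_comp[OF P(1) effective_collapse]])
  show "R_set A \<le>\<^sub>g R_set B"
    unfolding generic_reducible_iff_effective
  proof (intro exI[of _ "\<lambda>Y. spread {n. P {z. collapse Y z} n}"] conjI eff allI impI)
    fix \<Psi> assume \<Psi>: "generic_description \<Psi> (R_set B)"
    show "\<exists>\<Theta>. generic_description \<Theta> (R_set A) \<and>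
        {z. spread {n. P {z. collapse (graph_codes \<Psi>) z} n} z} = graph_codes \<Theta>"
      unfolding collapse_generic_description[OF \<Psi>] P(2) spread_char_graph
      using generic_description_total unfolding char_graph_def by blast
  qed
qed

section \<open>Degrees\<close>

lemma generic_degree_cong:
  assumes "A \<le>\<^sub>g B" "B \<le>\<^sub>g A"
  shows "generic_degree A = generic_degree B"
  unfolding generic_degree_def
  using generic_reducible_trans[OF _ assms(1)] generic_reducible_trans[OF _ assms(2)]
    generic_reducible_trans[OF assms(1)] generic_reducible_trans[OF assms(2)] by blast

lemma generic_degree_le_iff:
  "generic_degree_le (generic_degree A) (generic_degree B) \<longleftrightarrow> A \<le>\<^sub>g B"
proof
  assume "generic_degree_le (generic_degree A) (generic_degree B)"
  then obtain A' B' where "A \<le>\<^sub>g A'" "A' \<le>\<^sub>g B'" "B' \<le>\<^sub>g B"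
    unfolding generic_degree_le_def generic_degree_def by blast
  then show "A \<le>\<^sub>g B" by (intro generic_reducible_trans[of A A' B] generic_reducible_trans[of A' B' B])
next
  assume "A \<le>\<^sub>g B"
  then show "generic_degree_le (generic_degree A) (generic_degree B)"
    unfolding generic_degree_le_def generic_degree_def
    by (intro bexI[of _ A] bexI[of _ B]) (simp_all add: generic_reducible_refl)
qed

lemma turing_degree_le_iff:
  "turing_degree_le (turing_degree A) (turing_degree B) \<longleftrightarrow> A \<le>\<^sub>T B"
proof
  assume "turing_degree_le (turing_degree A) (turing_degree B)"
  then obtain A' B' where "A \<le>\<^sub>T A'" "A' \<le>\<^sub>T B'" "B' \<le>\<^sub>T B"
    unfolding turing_degree_le_def turing_degree_def by blast
  then show "A \<le>\<^sub>T B" by (intro turing_reducible_trans[of A A' B] turing_reducible_trans[of A' B' B])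
next
  assume "A \<le>\<^sub>T B"
  then show "turing_degree_le (turing_degree A) (turing_degree B)"
    unfolding turing_degree_le_def turing_degree_def
    by (intro bexI[of _ A] bexI[of _ B]) (simp_all add: turing_reducible_refl)
qed

lemma degree_map_eq:
  assumes "A \<in> turing_degree C"
  shows "degree_map (turing_degree C) = generic_degree (R_set A)"
proof -
  let ?S = "SOME S. S \<in> turing_degree C"
  have "?S \<in> turing_degree C" using assms by (rule someI)
  then have "?S \<le>\<^sub>T A" "A \<le>\<^sub>T ?S"
    using assms by (auto simp: turing_degree_def intro: turing_reducible_trans[of _ C])
  then show ?thesis
    unfolding degree_map_def by (intro generic_degree_cong) (simp_all add: R_set_generic_reducible_iff)
qed

theorem theorem4p7:
  "(\<forall>a\<in>turing_degrees. \<forall>A\<in>a. degree_map a = generic_degree (R_set A)) \<and>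
   order_embedding turing_degrees turing_degree_le generic_degrees generic_degree_le degree_map"
proof
  show "\<forall>a\<in>turing_degrees. \<forall>A\<in>a. degree_map a = generic_degree (R_set A)"
    unfolding turing_degrees_def using degree_map_eq by blast
  have map: "degree_map (turing_degree A) = generic_degree (R_set A)" for A
    by (rule degree_map_eq) (simp add: turing_degree_def turing_reducible_refl)
  show "order_embedding turing_degrees turing_degree_le generic_degrees generic_degree_le degree_map"
    unfolding order_embedding_def turing_degrees_def generic_degrees_def
    by (auto simp: map turing_degree_le_iff generic_degree_le_iff R_set_generic_reducible_iff)
qed

end
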